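(* For every integer $N\ge1$, the dimension of the energy-preserving subgroup $H^{(N)}\mathrm{SU}(2^N) := \{A\in\mathrm{SU}(2^N): AH^{(N)}=H^{(N)}A\}$ as a real manifold is $$\dim_{\mathbb{R}} H^{(N)}\mathrm{SU}(2^N) = \binom{2N}{N}-1,$$ and this quantity is $\mathcal{O}\!\left(\frac{4^N}{\sqrt N}\right)$ as $N\to\infty$.
   Context: Let $\sigma_0$ be the $2\times2$ identity matrix and $H=\begin{pmatrix}0&0\\0&1\end{pmatrix}$. The $N$-qubit Hamiltonian is the $2^N\times2^N$ matrix $H^{(N)} := \sum_{j=1}^N \sigma_0^{\otimes (j-1)}\otimes H\otimes\sigma_0^{\otimes(N-j)}$, with $\otimes$ the Kronecker product. $\mathrm{SU}(2^N)$ is the group of unitary $2^N\times 2^N$ matrices with determinant one, and $H^{(N)}\mathrm{SU}(2^N)$ is a Lie subgroup of it. *)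

theory Defs
  imports
    "HOL-Analysis.Function_Topology"
    "HOL-Library.Landau_Symbols"
    "Jordan_Normal_Form.Schur_Decomposition"
begin

section \<open>Smooth submanifolds of Euclidean space\<close>

text \<open>
  For a finite index set \<open>I\<close>, the Euclidean space with coordinates indexed by \<open>I\<close> is the set of
  functions vanishing outside \<open>I\<close>, with the subspace topology of the product topology. For
  \<open>I = {..<d}\<close> this is the carrier and the topology of \<open>Euclidean_space d\<close>. Carrying the index
  set as a term lets the dimension vary within a formula.
\<close>

definition coord_space :: "'i set \<Rightarrow> ('i \<Rightarrow> real) set" where
  "coord_space I = {x. \<forall>i. i \<notin> I \<longrightarrow> x i = 0}"

definition open_in_coord_space :: "'i set \<Rightarrow> ('i \<Rightarrow> real) set \<Rightarrow> bool" where
  "open_in_coord_space I U \<longleftrightarrow> openin (top_of_set (coord_space I)) U"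

text \<open>
  \<open>C_k_on I U k f\<close>: the real function \<open>f\<close> is of class \<open>C\<^sup>k\<close> on the open set \<open>U\<close>, that is, all its
  iterated partial derivatives in the coordinates \<open>I\<close> up to order \<open>k\<close> exist and are continuous
  on \<open>U\<close>; the function \<open>g\<close> below is the \<open>i\<close>-th partial derivative.
\<close>

primrec C_k_on :: "'i set \<Rightarrow> ('i \<Rightarrow> real) set \<Rightarrow> nat \<Rightarrow> (('i \<Rightarrow> real) \<Rightarrow> real) \<Rightarrow> bool" where
  "C_k_on I U 0 f \<longleftrightarrow> continuous_on U f"
| "C_k_on I U (Suc k) f \<longleftrightarrow> continuous_on U f \<and>
     (\<forall>i\<in>I. \<exists>g. (\<forall>x\<in>U. ((\<lambda>t. f (x(i := t))) has_real_derivative g x) (at (x i))) \<and> C_k_on I U k g)"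

definition smooth_map ::
    "'i set \<Rightarrow> ('i \<Rightarrow> real) set \<Rightarrow> 'j set \<Rightarrow> (('i \<Rightarrow> real) \<Rightarrow> 'j \<Rightarrow> real) \<Rightarrow> bool" where
  "smooth_map I U J f \<longleftrightarrow>
     (\<forall>x\<in>U. f x \<in> coord_space J) \<and> (\<forall>j\<in>J. \<forall>k. C_k_on I U k (\<lambda>x. f x j))"

text \<open>
  \<open>M\<close> is a (boundaryless, embedded) smooth \<open>d\<close>-dimensional submanifold: every point has a relatively
  open neighbourhood \<open>V \<inter> M\<close> diffeomorphic to an open subset \<open>W\<close> of \<open>d\<close>-dimensional space, where
  the chart \<open>\<phi>\<close>, being defined on a subset of the ambient space, is smooth in the sense of
  having a smooth extension to the ambient open set \<open>V\<close>. The last two conditions say that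
  \<open>\<psi> : W \<rightarrow> V \<inter> M\<close> is a bijection with inverse \<open>\<phi>\<close>.
\<close>

definition smooth_submanifold :: "'i set \<Rightarrow> nat \<Rightarrow> ('i \<Rightarrow> real) set \<Rightarrow> bool" where
  "smooth_submanifold I d M \<longleftrightarrow> M \<subseteq> coord_space I \<and>
     (\<forall>p\<in>M. \<exists>V W \<phi> \<psi>.
        open_in_coord_space I V \<and> p \<in> V \<and> open_in_coord_space {..<d} W \<and>
        smooth_map I V {..<d} \<phi> \<and> smooth_map {..<d} W I \<psi> \<and>
        \<psi> ` W = V \<inter> M \<and> (\<forall>w\<in>W. \<phi> (\<psi> w) = w))"

text \<open>
  Complex \<open>n \<times> n\<close> matrices form a real Euclidean space of dimension \<open>2n\<^sup>2\<close>, with coordinates the real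
  parts (index \<open>(i, j, False)\<close>) and imaginary parts (index \<open>(i, j, True)\<close>) of the entries.
\<close>

definition mat_index :: "nat \<Rightarrow> (nat \<times> nat \<times> bool) set" where
  "mat_index n = {..<n} \<times> {..<n} \<times> UNIV"

definition mat_coords :: "nat \<Rightarrow> complex mat \<Rightarrow> nat \<times> nat \<times> bool \<Rightarrow> real" where
  "mat_coords n A = (\<lambda>(i, j, im).
     if i < n \<and> j < n then (if im then Im (A $$ (i, j)) else Re (A $$ (i, j))) else 0)"

definition mat_submanifold :: "nat \<Rightarrow> nat \<Rightarrow> complex mat set \<Rightarrow> bool" where
  "mat_submanifold n d M \<longleftrightarrow>
     M \<subseteq> carrier_mat n n \<and> smooth_submanifold (mat_index n) d (mat_coords n ` M)"

text \<open>
  The dimension of a nonempty submanifold of the space of complex \<open>n \<times> n\<close> matrices. By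
  invariance of domain at most one \<open>d\<close> qualifies; the value is unspecified if \<open>M\<close> is not a
  submanifold.
\<close>

definition manifold_dim :: "nat \<Rightarrow> complex mat set \<Rightarrow> nat" where
  "manifold_dim n M = (THE d. mat_submanifold n d M)"

section \<open>The qubit Hamiltonian and its energy-preserving group\<close>

definition kronecker :: "'a::semiring_0 mat \<Rightarrow> 'a mat \<Rightarrow> 'a mat" (infixl \<open>\<otimes>\<^sub>K\<close> 70) where
  "A \<otimes>\<^sub>K B = Matrix.mat (dim_row A * dim_row B) (dim_col A * dim_col B)
     (\<lambda>(i, j). A $$ (i div dim_row B, j div dim_col B) * B $$ (i mod dim_row B, j mod dim_col B))"

primrec kronecker_power :: "'a::semiring_1 mat \<Rightarrow> nat \<Rightarrow> 'a mat" where
  "kronecker_power A 0 = 1\<^sub>m 1"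
| "kronecker_power A (Suc k) = kronecker_power A k \<otimes>\<^sub>K A"

definition sigma0 :: "complex mat" where
  "sigma0 = 1\<^sub>m 2"

definition qubit_H :: "complex mat" where
  "qubit_H = mat_of_rows_list 2 [[0, 0], [0, 1]]"

definition hamiltonian :: "nat \<Rightarrow> complex mat" where
  "hamiltonian N = finsum (module_mat TYPE(complex) (2 ^ N) (2 ^ N))
     (\<lambda>j. kronecker_power sigma0 (j - 1) \<otimes>\<^sub>K qubit_H \<otimes>\<^sub>K kronecker_power sigma0 (N - j)) {1..N}"

definition SU :: "nat \<Rightarrow> complex mat set" where
  "SU n = {A \<in> carrier_mat n n.
     A * mat_adjoint A = 1\<^sub>m n \<and> mat_adjoint A * A = 1\<^sub>m n \<and> Determinant.det A = 1}"

definition energy_preserving_SU :: "nat \<Rightarrow> complex mat set" where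
  "energy_preserving_SU N =
     {A \<in> SU (2 ^ N). A * hamiltonian N = hamiltonian N * A}"

end

theory Submission
  imports Defs "HOL-Homology.Invariance_of_Domain" "HOL-Library.Nat_Bijection"
begin

text \<open>
  The Hamiltonian is diagonal, with the number of binary digits 1 of \<open>i\<close> as its \<open>i\<close>-th entry, so
  the matrices commuting with it are the block matrices whose blocks are indexed by the \<open>N choose k\<close>
  indices of weight \<open>k\<close>. The skew-Hermitian block matrices have real dimension
  \<open>\<Sum>k\<le>N. (N choose k)\<^sup>2 = 2N choose N\<close>, and the determinant condition removes one dimension.
  Charts are given by the Cayley transform, which is rational and interchanges unitary and
  skew-Hermitian matrices. Since the index 0 is alone in its block, the determinant condition
  just solves for the corner entry, and no implicit function theorem is needed. Uniqueness of the
  dimension is invariance of domain.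
\<close>

section \<open>Smooth functions\<close>

text \<open>Because the Cayley transform is rational, smoothness reduces to closure of iterated
  partial derivatives under sums, products and reciprocals, once inverses are written as adjugate
  over determinant. Since \<open>1 + X\<close> is invertible for every skew-Hermitian
  \<open>X\<close>, the parameter domain of each chart is a whole Euclidean space. Unitary matrices
  with eigenvalue -1 are missed, so charts are translated by group elements. The obstacle is the
  determinant: under the Cayley transform, determinant one does not become a linear condition such
  as trace zero. The charts therefore parametrize block unitaries with corner entry 1, which
  correspond to the linear space of skew-Hermitian block matrices with corner entry 0. Resetting the
  corner to the inverse of the determinant then lands in the special unitary group, and restoring
  the corner to 1 undoes this.\<close>

lemma C_k_on_SucD: "C_k_on I U (Suc k) f \<Longrightarrow> C_k_on I U k f"
proof (induction k arbitrary: f)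
  case (Suc k)
  then show ?case by (simp only: C_k_on.simps) blast
qed simp

lemma C_k_on_const: "C_k_on I U k (\<lambda>x. c)"
proof (induction k arbitrary: c)
  case (Suc k)
  then show ?case by (auto intro!: exI[of _ "\<lambda>x. 0"] derivative_eq_intros)
qed simp

lemma C_k_on_coordinate: "C_k_on I U k (\<lambda>x. x j)"
proof -
  have cont: "continuous_on U (\<lambda>x. x j)"
    by (rule continuous_on_subset[OF continuous_on_product_coordinates]) simp
  show ?thesis
  proof (cases k)
    case (Suc l)
    have "\<exists>g. (\<forall>x\<in>U. ((\<lambda>t. (x(i := t)) j) has_real_derivative g x) (at (x i))) \<and> C_k_on I U l g" for i
      by (rule exI[of _ "\<lambda>x. if i = j then 1 else 0"])
        (auto intro!: derivative_eq_intros C_k_on_const)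
    with cont Suc show ?thesis by (simp del: fun_upd_apply)
  qed (simp add: cont)
qed

lemma C_k_on_add:
  "C_k_on I U k f \<Longrightarrow> C_k_on I U k g \<Longrightarrow> C_k_on I U k (\<lambda>x. f x + g x)"
proof (induction k arbitrary: f g)
  case (Suc k)
  have "\<exists>h. (\<forall>x\<in>U. ((\<lambda>t. f (x(i := t)) + g (x(i := t))) has_real_derivative h x) (at (x i))) \<and> C_k_on I U k h"
    if i: "i \<in> I" for i
  proof -
    obtain f' where f': "\<forall>x\<in>U. ((\<lambda>t. f (x(i := t))) has_real_derivative f' x) (at (x i))" "C_k_on I U k f'"
      using Suc.prems(1) i by auto
    obtain g' where g': "\<forall>x\<in>U. ((\<lambda>t. g (x(i := t))) has_real_derivative g' x) (at (x i))" "C_k_on I U k g'"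
      using Suc.prems(2) i by auto
    show ?thesis
      using f' g' Suc.IH by (intro exI[of _ "\<lambda>x. f' x + g' x"]) (auto intro!: DERIV_add)
  qed
  with Suc.prems show ?case by (auto intro: continuous_on_add)
qed (auto intro: continuous_on_add)

lemma C_k_on_mult:
  "C_k_on I U k f \<Longrightarrow> C_k_on I U k g \<Longrightarrow> C_k_on I U k (\<lambda>x. f x * g x)"
proof (induction k arbitrary: f g)
  case (Suc k)
  \<comment> \<open>The product rule contains \<open>f\<close> and \<open>g\<close> themselves, now
    at the lower order.\<close>
  note le = C_k_on_SucD[OF Suc.prems(1)] C_k_on_SucD[OF Suc.prems(2)]
  have "\<exists>h. (\<forall>x\<in>U. ((\<lambda>t. f (x(i := t)) * g (x(i := t))) has_real_derivative h x) (at (x i))) \<and> C_k_on I U k h"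
    if i: "i \<in> I" for i
  proof -
    obtain f' where f': "\<forall>x\<in>U. ((\<lambda>t. f (x(i := t))) has_real_derivative f' x) (at (x i))" "C_k_on I U k f'"
      using Suc.prems(1) i by auto
    obtain g' where g': "\<forall>x\<in>U. ((\<lambda>t. g (x(i := t))) has_real_derivative g' x) (at (x i))" "C_k_on I U k g'"
      using Suc.prems(2) i by auto
    show ?thesis
    proof (intro exI[of _ "\<lambda>x. f' x * g x + g' x * f x"] conjI ballI)
      fix x assume "x \<in> U"
      then show "((\<lambda>t. f (x(i := t)) * g (x(i := t))) has_real_derivative f' x * g x + g' x * f x) (at (x i))"
        using DERIV_mult[OF f'(1)[rule_format, of x] g'(1)[rule_format, of x]] by simp
    qed (intro C_k_on_add Suc.IH f' g' le)
  qed
  with Suc.prems show ?case by (auto intro: continuous_on_mult)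
qed (auto intro: continuous_on_mult)

text \<open>The derivative of \<open>1 / f\<close> is built from \<open>f'\<close> and
  \<open>1 / f\<close> again, so the induction on the order runs with \<open>f\<close>
  fixed.\<close>

lemma C_k_on_inverse:
  assumes nz: "\<forall>x\<in>U. f x \<noteq> 0"
  shows "C_k_on I U k f \<Longrightarrow> C_k_on I U k (\<lambda>x. inverse (f x))"
proof (induction k)
  case 0
  then show ?case using nz by (auto intro: continuous_on_inverse)
next
  case (Suc k)
  note IH = Suc.IH[OF C_k_on_SucD[OF Suc.prems]]
  have "\<exists>h. (\<forall>x\<in>U. ((\<lambda>t. inverse (f (x(i := t)))) has_real_derivative h x) (at (x i))) \<and> C_k_on I U k h"
    if i: "i \<in> I" for i
  proof -
    obtain f' where f': "\<forall>x\<in>U. ((\<lambda>t. f (x(i := t))) has_real_derivative f' x) (at (x i))" "C_k_on I U k f'"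
      using Suc.prems i by auto
    show ?thesis
    proof (intro exI[of _ "\<lambda>x. (-1) * (inverse (f x) * f' x * inverse (f x))"] conjI ballI)
      fix x assume "x \<in> U"
      then show "((\<lambda>t. inverse (f (x(i := t)))) has_real_derivative
          (-1) * (inverse (f x) * f' x * inverse (f x))) (at (x i))"
        using DERIV_inverse'[OF f'(1)[rule_format, of x]] nz by simp
    qed (intro C_k_on_mult C_k_on_const IH f')
  qed
  with Suc.prems nz show ?case by (auto intro: continuous_on_inverse)
qed

section \<open>Smooth complex-valued and matrix-valued functions of real coordinates\<close>

definition smooth_complex :: "'i set \<Rightarrow> ('i \<Rightarrow> real) set \<Rightarrow> (('i \<Rightarrow> real) \<Rightarrow> complex) \<Rightarrow> bool" where
  "smooth_complex I U f \<longleftrightarrow>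
     (\<forall>k. C_k_on I U k (\<lambda>x. Re (f x)) \<and> C_k_on I U k (\<lambda>x. Im (f x)))"

lemma smooth_complex_Complex:
  "(\<And>k. C_k_on I U k f) \<Longrightarrow> (\<And>k. C_k_on I U k g) \<Longrightarrow> smooth_complex I U (\<lambda>x. Complex (f x) (g x))"
  by (simp add: smooth_complex_def)

lemma smooth_complex_const: "smooth_complex I U (\<lambda>x. c)"
  by (simp add: smooth_complex_def C_k_on_const)

lemma smooth_complex_add:
  "smooth_complex I U f \<Longrightarrow> smooth_complex I U g \<Longrightarrow> smooth_complex I U (\<lambda>x. f x + g x)"
  by (simp add: smooth_complex_def C_k_on_add)

lemma smooth_complex_mult:
  assumes "smooth_complex I U f" "smooth_complex I U g"
  shows "smooth_complex I U (\<lambda>x. f x * g x)"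
proof -
  have "C_k_on I U k (\<lambda>x. Re (f x) * Re (g x) + (-1) * (Im (f x) * Im (g x)))"
    "C_k_on I U k (\<lambda>x. Re (f x) * Im (g x) + Im (f x) * Re (g x))" for k
    using assms unfolding smooth_complex_def by (intro C_k_on_add C_k_on_mult C_k_on_const; blast)+
  then show ?thesis by (simp add: smooth_complex_def)
qed

lemma smooth_complex_diff:
  "smooth_complex I U f \<Longrightarrow> smooth_complex I U g \<Longrightarrow> smooth_complex I U (\<lambda>x. f x - g x)"
  using smooth_complex_add[OF _ smooth_complex_mult[OF smooth_complex_const[of _ _ "-1"]], of I U f g] by simp

lemma smooth_complex_inverse:
  assumes "smooth_complex I U f" "\<forall>x\<in>U. f x \<noteq> 0"
  shows "smooth_complex I U (\<lambda>x. inverse (f x))"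
proof -
  let ?n = "\<lambda>x. Re (f x) * Re (f x) + Im (f x) * Im (f x)"
  have nz: "\<forall>x\<in>U. ?n x \<noteq> 0"
    using assms(2) by (auto simp: complex_eq_iff sum_squares_eq_zero_iff)
  have "C_k_on I U k (\<lambda>x. Re (f x) * inverse (?n x))"
    "C_k_on I U k (\<lambda>x. (-1) * Im (f x) * inverse (?n x))" for k
    using assms(1) nz unfolding smooth_complex_def
    by (intro C_k_on_mult C_k_on_add C_k_on_const C_k_on_inverse; blast)+
  then show ?thesis by (simp add: smooth_complex_def divide_inverse power2_eq_square)
qed

lemma smooth_complex_divide:
  assumes "smooth_complex I U f" "smooth_complex I U g" "\<forall>x\<in>U. g x \<noteq> 0"
  shows "smooth_complex I U (\<lambda>x. f x / g x)"
  unfolding divide_inverse by (intro smooth_complex_mult smooth_complex_inverse assms)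

lemma smooth_complex_sum:
  "(\<And>a. a \<in> S \<Longrightarrow> smooth_complex I U (f a)) \<Longrightarrow> smooth_complex I U (\<lambda>x. \<Sum>a\<in>S. f a x)"
  by (induction S rule: infinite_finite_induct)
    (auto intro: smooth_complex_const smooth_complex_add)

lemma smooth_complex_prod:
  "(\<And>a. a \<in> S \<Longrightarrow> smooth_complex I U (f a)) \<Longrightarrow> smooth_complex I U (\<lambda>x. \<Prod>a\<in>S. f a x)"
  by (induction S rule: infinite_finite_induct)
    (auto intro: smooth_complex_const smooth_complex_mult)

lemma smooth_complex_continuous_on:
  assumes "smooth_complex I U f" shows "continuous_on U f"
proof -
  have "continuous_on U (\<lambda>x. Complex (Re (f x)) (Im (f x)))"
    using assms[unfolded smooth_complex_def, rule_format, of 0]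
    by (intro continuous_on_Complex) auto
  then show ?thesis by simp
qed

text \<open>The dimensions are fixed for every \<open>x\<close>, not only on \<open>U\<close>, so
  that entry formulas for products, determinants and adjugates can be rewritten under the
  binder.\<close>

definition smooth_mat ::
    "'i set \<Rightarrow> ('i \<Rightarrow> real) set \<Rightarrow> nat \<Rightarrow> (('i \<Rightarrow> real) \<Rightarrow> complex mat) \<Rightarrow> bool" where
  "smooth_mat I U n F \<longleftrightarrow> (\<forall>x. F x \<in> carrier_mat n n) \<and>
     (\<forall>i<n. \<forall>j<n. smooth_complex I U (\<lambda>x. F x $$ (i, j)))"

lemma smooth_matI:
  assumes "\<And>x. F x \<in> carrier_mat n n"
    and "\<And>i j. i < n \<Longrightarrow> j < n \<Longrightarrow> smooth_complex I U (\<lambda>x. F x $$ (i, j))"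
  shows "smooth_mat I U n F"
  using assms by (simp add: smooth_mat_def)

lemma smooth_matD:
  assumes "smooth_mat I U n F"
  shows "F x \<in> carrier_mat n n"
    and "i < n \<Longrightarrow> j < n \<Longrightarrow> smooth_complex I U (\<lambda>x. F x $$ (i, j))"
  using assms by (simp_all add: smooth_mat_def)

lemma smooth_mat_dims:
  "smooth_mat I U n F \<Longrightarrow> dim_row (F x) = n" "smooth_mat I U n F \<Longrightarrow> dim_col (F x) = n"
  using smooth_matD(1) by blast+

lemma smooth_mat_const: "A \<in> carrier_mat n n \<Longrightarrow> smooth_mat I U n (\<lambda>x. A)"
  by (simp add: smooth_mat_def smooth_complex_const)

lemma smooth_mat_add:
  assumes "smooth_mat I U n F" "smooth_mat I U n G"
  shows "smooth_mat I U n (\<lambda>x. F x + G x)"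
proof (rule smooth_matI)
  fix i j assume "i < n" "j < n"
  then show "smooth_complex I U (\<lambda>x. (F x + G x) $$ (i, j))"
    using smooth_matD[OF assms(1)] smooth_matD[OF assms(2)]
    by (subst index_add_mat) (auto simp: smooth_mat_dims[OF assms(2)] intro!: smooth_complex_add)
qed (use smooth_matD[OF assms(1)] smooth_matD[OF assms(2)] in auto)

lemma smooth_mat_diff:
  assumes "smooth_mat I U n F" "smooth_mat I U n G"
  shows "smooth_mat I U n (\<lambda>x. F x - G x)"
proof (rule smooth_matI)
  fix i j assume "i < n" "j < n"
  then show "smooth_complex I U (\<lambda>x. (F x - G x) $$ (i, j))"
    using smooth_matD[OF assms(1)] smooth_matD[OF assms(2)]
    by (subst index_minus_mat) (auto simp: smooth_mat_dims[OF assms(2)] intro!: smooth_complex_diff)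
next
  fix x show "F x - G x \<in> carrier_mat n n"
    using smooth_matD(1)[OF assms(2)] by (rule minus_carrier_mat)
qed

lemma smooth_mat_smult:
  assumes "smooth_complex I U f" "smooth_mat I U n F"
  shows "smooth_mat I U n (\<lambda>x. f x \<cdot>\<^sub>m F x)"
proof (rule smooth_matI)
  fix i j assume "i < n" "j < n"
  then show "smooth_complex I U (\<lambda>x. (f x \<cdot>\<^sub>m F x) $$ (i, j))"
    using smooth_matD[OF assms(2)] assms(1)
    by (subst index_smult_mat) (auto simp: smooth_mat_dims[OF assms(2)] intro!: smooth_complex_mult)
qed (use smooth_matD[OF assms(2)] in auto)

lemma smooth_mat_mult:
  assumes "smooth_mat I U n F" "smooth_mat I U n G"
  shows "smooth_mat I U n (\<lambda>x. F x * G x)"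
proof (rule smooth_matI)
  fix i j assume ij: "i < n" "j < n"
  have "(F x * G x) $$ (i, j) = (\<Sum>k\<in>{0..<n}. F x $$ (i, k) * G x $$ (k, j))" for x
    using smooth_matD(1)[OF assms(1), of x] smooth_matD(1)[OF assms(2), of x] ij
    by (auto simp: scalar_prod_def intro!: sum.cong)
  then show "smooth_complex I U (\<lambda>x. (F x * G x) $$ (i, j))"
    using smooth_matD(2)[OF assms(1)] smooth_matD(2)[OF assms(2)] ij
    by (auto intro!: smooth_complex_sum smooth_complex_mult)
next
  fix x show "F x * G x \<in> carrier_mat n n"
    using smooth_matD(1)[OF assms(1)] smooth_matD(1)[OF assms(2)] by (rule mult_carrier_mat)
qed

lemma smooth_complex_det:
  assumes "smooth_mat I U n F"
  shows "smooth_complex I U (\<lambda>x. Determinant.det (F x))"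
proof -
  have "Determinant.det (F x) =
      (\<Sum>p\<in>{p. p permutes {0..<n}}. signof p * (\<Prod>i = 0..<n. F x $$ (i, p i)))" for x
    by (rule det_def'[OF smooth_matD(1)[OF assms]])
  moreover have "p i < n" if "p permutes {0..<n}" "i < n" for p i
    using that by (metis atLeastLessThan_iff permutes_in_image zero_le)
  ultimately show ?thesis
    using assms by (auto intro!: smooth_complex_sum smooth_complex_mult smooth_complex_const
        smooth_complex_prod smooth_matD(2))
qed

lemma smooth_mat_adj_mat:
  assumes "smooth_mat I U n F"
  shows "smooth_mat I U n (\<lambda>x. adj_mat (F x))"
proof (rule smooth_matI)
  note c = smooth_matD(1)[OF assms]
  fix i j assume ij: "i < n" "j < n"
  have "smooth_mat I U (n - 1) (\<lambda>x. mat_delete (F x) j i)"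
  proof (rule smooth_matI)
    fix k l assume kl: "k < n - 1" "l < n - 1"
    \<comment> \<open>Deleting row \<open>j\<close> and column \<open>i\<close> shifts the later
      indices by one.\<close>
    let ?k = "if k < j then k else Suc k" and ?l = "if l < i then l else Suc l"
    have "mat_delete (F x) j i $$ (k, l) = F x $$ (?k, ?l)" for x
      using c[of x] kl by (auto simp: mat_delete_def)
    then show "smooth_complex I U (\<lambda>x. mat_delete (F x) j i $$ (k, l))"
      using kl by (simp only:) (rule smooth_matD(2)[OF assms], auto)
  qed (rule mat_delete_carrier[OF c])
  moreover have "adj_mat (F x) $$ (i, j) = (- 1) ^ (j + i) * Determinant.det (mat_delete (F x) j i)" for x
    using c[of x] ij by (simp add: adj_mat_def cofactor_def)
  ultimately show "smooth_complex I U (\<lambda>x. adj_mat (F x) $$ (i, j))"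
    by (auto intro!: smooth_complex_mult smooth_complex_const smooth_complex_det)
qed (use smooth_matD(1)[OF assms] in \<open>auto intro: adj_mat(1)\<close>)

section \<open>Invariance of the dimension\<close>

lemma Euclidean_space_eq: "Euclidean_space d = top_of_set (coord_space {..<d})"
  by (simp add: Euclidean_space_def coord_space_def euclidean_product_topology not_less)

lemma smooth_map_continuous_on:
  assumes "smooth_map I U J f" shows "continuous_on U f"
proof (rule continuous_on_coordinatewise_then_product)
  fix j
  show "continuous_on U (\<lambda>x. f x j)"
  proof (cases "j \<in> J")
    case True
    then have "C_k_on I U 0 (\<lambda>x. f x j)" using assms by (simp only: smooth_map_def)
    then show ?thesis by simp
  next
    case False
    then have "f x j = 0" if "x \<in> U" for x
      using assms that by (auto simp: smooth_map_def coord_space_def)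
    then show ?thesis using continuous_on_cong[of U U "\<lambda>x. f x j" "\<lambda>x. 0"] by simp
  qed
qed

text \<open>An open set contains with \<open>y\<close> a short segment in direction
  \<open>i\<close>, and this segment leaves the hyperplane.\<close>

lemma not_openin_coord_hyperplane:
  assumes S: "openin (top_of_set (coord_space {..<d})) S" and y: "y \<in> S"
    and i: "i < d" and hyp: "\<And>x. x \<in> S \<Longrightarrow> x i = 0"
  shows False
proof -
  obtain T where T: "open T" "S = coord_space {..<d} \<inter> T"
    using S by (auto simp: openin_open)
  have "continuous_on UNIV (\<lambda>t. y(i := t))"
  proof (rule continuous_on_coordinatewise_then_product)
    show "continuous_on UNIV (\<lambda>t. (y(i := t)) j)" for j
      by (cases "j = i") auto
  qed
  then have op: "open ((\<lambda>t. y(i := t)) -` T)"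
    using T(1) by (rule open_vimage[rotated])
  have "0 \<in> (\<lambda>t. y(i := t)) -` T"
    using T(2) y hyp[OF y] fun_upd_triv[of y i] by simp
  then obtain e where e: "e > 0" "ball 0 e \<subseteq> (\<lambda>t. y(i := t)) -` T"
    using op by (meson open_contains_ball)
  have "e / 2 \<in> ball 0 e" using e(1) by (simp add: dist_norm)
  then have "e / 2 \<in> (\<lambda>t. y(i := t)) -` T" using e(2) by (rule subsetD[rotated])
  then have "y(i := e / 2) \<in> S"
    using y i by (auto simp: T(2) coord_space_def)
  from hyp[OF this] e(1) show False by simp
qed

text \<open>If \<open>d' < d\<close>, the transition map from the first chart to the second is a
  continuous injection of a nonempty open set of dimension \<open>d\<close> into dimension
  \<open>d'\<close>. Viewed in dimension \<open>d\<close>, its image is open by invariance of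
  domain, yet its coordinate with index \<open>d'\<close> is constantly 0.\<close>

lemma smooth_submanifold_dim_le:
  assumes "smooth_submanifold I d M" "smooth_submanifold I d' M" "p \<in> M"
  shows "d \<le> d'"
proof (rule ccontr)
  assume "\<not> d \<le> d'"
  then have less: "d' < d" by simp
  from assms(1)[unfolded smooth_submanifold_def, THEN conjunct2, THEN bspec, OF assms(3)]
  obtain V W \<phi> \<psi> where c: "p \<in> V" "open_in_coord_space {..<d} W" "smooth_map {..<d} W I \<psi>"
      "\<psi> ` W = V \<inter> M" "\<forall>w\<in>W. \<phi> (\<psi> w) = w"
    by (elim exE conjE) (rule that; assumption)
  from assms(2)[unfolded smooth_submanifold_def, THEN conjunct2, THEN bspec, OF assms(3)]
  obtain V' W' \<phi>' \<psi>' where c': "open_in_coord_space I V'" "p \<in> V'" "smooth_map I V' {..<d'} \<phi>'"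
      "\<psi>' ` W' = V' \<inter> M" "\<forall>w\<in>W'. \<phi>' (\<psi>' w) = w"
    by (elim exE conjE) (rule that; assumption)
  define U where "U = W \<inter> \<psi> -` V'"
  have \<psi>: "continuous_on W \<psi>" "\<psi> \<in> W \<rightarrow> coord_space I"
    using c(3) smooth_map_continuous_on by (auto simp: smooth_map_def)
  have "openin (top_of_set W) U"
    unfolding U_def by (rule continuous_openin_preimage[OF \<psi>]) (use c'(1) in \<open>simp add: open_in_coord_space_def\<close>)
  then have U: "openin (Euclidean_space d) U"
    using c(2) openin_trans unfolding Euclidean_space_eq open_in_coord_space_def by blast
  have "p \<in> \<psi> ` W" using c(1,4) assms(3) by simp
  then obtain u where u: "u \<in> U" using c'(2) unfolding U_def by auto
  let ?F = "\<lambda>w. \<phi>' (\<psi> w)"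
  have F: "continuous_on U ?F" "?F ` U \<subseteq> coord_space {..<d'}"
  proof -
    have "continuous_on V' \<phi>'" using c'(3) by (rule smooth_map_continuous_on)
    then show "continuous_on U ?F"
      using continuous_on_compose2[of V' \<phi>' U \<psi>] continuous_on_subset[OF \<psi>(1), of U] by (auto simp: U_def)
    show "?F ` U \<subseteq> coord_space {..<d'}" using c'(3) by (auto simp: U_def smooth_map_def)
  qed
  have sub: "coord_space {..<d'} \<subseteq> coord_space {..<d}" using less by (auto simp: coord_space_def)
  have Usub: "U \<subseteq> coord_space {..<d}"
    using U unfolding Euclidean_space_eq by (rule openin_imp_subset)
  have inj: "inj_on ?F U"
  proof (rule inj_onI)
    fix v w assume vw: "v \<in> U" "w \<in> U" "?F v = ?F w"
    have "\<psi>' (\<phi>' (\<psi> x)) = \<psi> x" if "x \<in> U" for x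
    proof -
      have "\<psi> x \<in> \<psi>' ` W'" using that c(4) c'(4) by (auto simp: U_def)
      then show ?thesis using c'(5) by auto
    qed
    then have "\<psi> v = \<psi> w" using vw by metis
    then show "v = w" using vw c(5) by (metis IntD1 U_def)
  qed
  have "openin (Euclidean_space d) (?F ` U)"
  proof (rule invariance_of_domain_Euclidean_space[OF U _ inj])
    show "continuous_map (subtopology (Euclidean_space d) U) (Euclidean_space d) ?F"
      using F sub Usub unfolding Euclidean_space_eq
      by (simp add: subtopology_subtopology Int_absorb1 image_subset_iff_funcset[symmetric])
  qed
  then show False
    unfolding Euclidean_space_eq
    by (rule not_openin_coord_hyperplane[of d _ "?F u" d'])
      (use u less F(2) in \<open>auto simp: coord_space_def\<close>)
qed

text \<open>Nonemptiness supplies the point at which two dimensions are compared; the empty set is a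
  submanifold of every dimension.\<close>

lemma manifold_dim_eq:
  assumes "mat_submanifold n d M" "M \<noteq> {}"
  shows "manifold_dim n M = d"
  unfolding manifold_dim_def
proof (rule the_equality)
  fix d' assume "mat_submanifold n d' M"
  with assms show "d' = d"
    unfolding mat_submanifold_def by (blast intro: antisym smooth_submanifold_dim_le)
qed (rule assms)

section \<open>The Cayley transform and block matrices\<close>

lemma mat_eq_iff_index:
  assumes "A \<in> carrier_mat n n" "B \<in> carrier_mat n n"
  shows "A = B \<longleftrightarrow> (\<forall>i<n. \<forall>j<n. A $$ (i, j) = B $$ (i, j))"
  using assms by (auto intro!: eq_matI)

lemma mat_add_left_cancel:
  fixes A :: "'a::group_add mat"
  assumes "A \<in> carrier_mat n n" "B \<in> carrier_mat n n" "C \<in> carrier_mat n n"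
  shows "A + B = A + C \<longleftrightarrow> B = C"
  using assms by (simp add: mat_eq_iff_index[of _ n])

lemma smult_mat_cancel:
  fixes c :: complex
  assumes "c \<noteq> 0" "A \<in> carrier_mat n n" "B \<in> carrier_mat n n"
  shows "c \<cdot>\<^sub>m A = c \<cdot>\<^sub>m B \<longleftrightarrow> A = B"
  using assms by (simp add: mat_eq_iff_index[of _ n])

context
  fixes A :: "complex mat" and n :: nat
  assumes A: "A \<in> carrier_mat n n"
begin

lemma mat_adjoint_carrier: "mat_adjoint A \<in> carrier_mat n n"
  using A by (auto simp: mat_adjoint_def)

lemma mat_adjoint_index: "i < n \<Longrightarrow> j < n \<Longrightarrow> mat_adjoint A $$ (i, j) = cnj (A $$ (j, i))"
  using A by (auto simp: mat_adjoint_def mat_of_rows_index)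

lemma mat_adjoint_adjoint: "mat_adjoint (mat_adjoint A) = A"
  using A by (auto simp: mat_adjoint_def mat_of_rows_index)

lemma det_mat_adjoint: "Determinant.det (mat_adjoint A) = cnj (Determinant.det A)"
proof -
  interpret comm_ring_hom cnj by unfold_locales auto
  have "mat_adjoint A = map_mat cnj (transpose_mat A)"
    using A by (auto simp: mat_adjoint_def mat_of_rows_index)
  then show ?thesis
    by (simp add: det_transpose[OF A])
qed

lemma mat_adjoint_add:
  assumes "B \<in> carrier_mat n n"
  shows "mat_adjoint (A + B) = mat_adjoint A + mat_adjoint B"
  using A assms by (auto simp: mat_adjoint_def mat_of_rows_index)

lemma mat_adjoint_mult:
  assumes "B \<in> carrier_mat n n"
  shows "mat_adjoint (A * B) = mat_adjoint B * mat_adjoint A"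
  using A assms by (auto simp: mat_adjoint_def mat_of_rows_index scalar_prod_def mult.commute intro!: eq_matI)

lemma mat_adjoint_smult: "mat_adjoint (c \<cdot>\<^sub>m A) = cnj c \<cdot>\<^sub>m mat_adjoint A"
  using A by (auto simp: mat_adjoint_def mat_of_rows_index)

end

lemma mat_adjoint_one: "mat_adjoint (1\<^sub>m n :: complex mat) = 1\<^sub>m n"
  by (auto simp: mat_adjoint_def mat_of_rows_index)

text \<open>The inverse by Cramer's rule: its entries are quotients of determinants, hence smooth
  wherever the determinant does not vanish.\<close>

definition adj_inverse :: "complex mat \<Rightarrow> complex mat" where
  "adj_inverse A = (1 / Determinant.det A) \<cdot>\<^sub>m adj_mat A"

lemma adj_inverse:
  assumes "A \<in> carrier_mat n n" "Determinant.det A \<noteq> 0"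
  shows "adj_inverse A \<in> carrier_mat n n" "A * adj_inverse A = 1\<^sub>m n" "adj_inverse A * A = 1\<^sub>m n"
  using adj_mat[OF assms(1)] assms
  by (auto simp: adj_inverse_def mult_smult_distrib[of _ n n _ n] mult_smult_assoc_mat[of _ n n _ n] mat_eq_iff_index[of _ n])

lemma det_nonzero_if_mult_eq:
  fixes A B :: "complex mat"
  assumes "A \<in> carrier_mat n n" "B \<in> carrier_mat n n" "A * B = c \<cdot>\<^sub>m 1\<^sub>m n" "c \<noteq> 0"
  shows "Determinant.det A \<noteq> 0" "Determinant.det B \<noteq> 0"
  using det_mult[OF assms(1,2)] assms(3,4) by auto

text \<open>The scalar \<open>c\<close> accommodates the 2 in the defining relation of the Cayley
  transform.\<close>

lemma adj_inverse_unique: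
  assumes A: "A \<in> carrier_mat n n" and B: "B \<in> carrier_mat n n" and AB: "A * B = c \<cdot>\<^sub>m 1\<^sub>m n" and c: "c \<noteq> 0"
  shows "c \<cdot>\<^sub>m adj_inverse A = B"
proof -
  note inv = adj_inverse[OF A det_nonzero_if_mult_eq(1)[OF assms]]
  have "adj_inverse A * (A * B) = c \<cdot>\<^sub>m adj_inverse A"
    using AB inv by (simp add: mult_smult_distrib[of _ n n _ n])
  moreover have "adj_inverse A * (A * B) = B"
    using assoc_mult_mat[OF inv(1) A B] inv(3) B by simp
  ultimately show ?thesis by simp
qed

text \<open>The Cayley transform \<open>(1 - A)(1 + A)\<^sup>-\<^sup>1\<close>, written so that \<open>(1 + cayley A)(1 + A) = 2\<close>
  is immediate; this relation is symmetric, which makes the transform an involution.\<close>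

definition cayley :: "nat \<Rightarrow> complex mat \<Rightarrow> complex mat" where
  "cayley n A = 2 \<cdot>\<^sub>m adj_inverse (1\<^sub>m n + A) - 1\<^sub>m n"

lemma cayley_carrier: "cayley n A \<in> carrier_mat n n"
  unfolding cayley_def by (rule minus_carrier_mat) simp

lemma one_add_carrier: "(A :: complex mat) \<in> carrier_mat n n \<Longrightarrow> 1\<^sub>m n + A \<in> carrier_mat n n"
  by auto

context
  fixes A :: "complex mat" and n :: nat
  assumes A: "A \<in> carrier_mat n n" and det: "Determinant.det (1\<^sub>m n + A) \<noteq> 0"
begin

lemmas inv1 = adj_inverse[OF one_add_carrier[OF A] det]

lemma one_add_cayley: "1\<^sub>m n + cayley n A = 2 \<cdot>\<^sub>m adj_inverse (1\<^sub>m n + A)"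
  unfolding cayley_def using inv1(1) by (intro eq_matI) auto

lemma cayley_mult:
  "(1\<^sub>m n + A) * (1\<^sub>m n + cayley n A) = 2 \<cdot>\<^sub>m 1\<^sub>m n"
  "(1\<^sub>m n + cayley n A) * (1\<^sub>m n + A) = 2 \<cdot>\<^sub>m 1\<^sub>m n"
  using inv1 one_add_carrier[OF A]
  by (simp_all add: one_add_cayley mult_smult_distrib[of _ n n _ n] mult_smult_assoc_mat[of _ n n _ n])

lemma det_one_add_cayley: "Determinant.det (1\<^sub>m n + cayley n A) \<noteq> 0"
  by (rule det_nonzero_if_mult_eq(1)[OF _ one_add_carrier[OF A] cayley_mult(2)]) (use cayley_carrier in auto)

lemma cayley_cayley: "cayley n (cayley n A) = A"
proof -
  have "2 \<cdot>\<^sub>m adj_inverse (1\<^sub>m n + cayley n A) = 1\<^sub>m n + A"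
    by (rule adj_inverse_unique[OF _ one_add_carrier[OF A] cayley_mult(2)]) (use cayley_carrier in auto)
  then show ?thesis
    unfolding cayley_def[of n "cayley n A"] using A by (auto simp: mat_eq_iff_index[of _ n])
qed

end

text \<open>Substituting \<open>A = P - 1\<close> and expanding restates unitarity in terms of
  \<open>P = 1 + A\<close>, the quantity for which the Cayley transform is a reciprocal up to the
  factor 2.\<close>

lemma adjoint_mult_self_eq_one_iff:
  fixes A :: "complex mat"
  assumes A: "A \<in> carrier_mat n n"
  shows "mat_adjoint A * A = 1\<^sub>m n \<longleftrightarrow>
    mat_adjoint (1\<^sub>m n + A) * (1\<^sub>m n + A) = (1\<^sub>m n + A) + mat_adjoint (1\<^sub>m n + A)"
proof -
  let ?B = "mat_adjoint A"
  note B = mat_adjoint_carrier[OF A]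
  have BA: "?B * A \<in> carrier_mat n n" using A B by auto
  have "mat_adjoint (1\<^sub>m n + A) = 1\<^sub>m n + ?B"
    using A by (simp add: mat_adjoint_add[of _ n] mat_adjoint_one)
  moreover have "(1\<^sub>m n + ?B) * (1\<^sub>m n + A) = (1\<^sub>m n + A) + (?B + ?B * A)"
  proof -
    have "(1\<^sub>m n + ?B) * (1\<^sub>m n + A) = (1\<^sub>m n + ?B) + (A + ?B * A)"
      using A B by (simp add: add_mult_distrib_mat[of _ n n _ _ n] mult_add_distrib_mat[of _ n n _ n])
    also have "\<dots> = (1\<^sub>m n + A) + (?B + ?B * A)"
      using A B BA by (intro eq_matI) auto
    finally show "(1\<^sub>m n + ?B) * (1\<^sub>m n + A) = (1\<^sub>m n + A) + (?B + ?B * A)" .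
  qed
  moreover have "(1\<^sub>m n + A) + (?B + ?B * A) = (1\<^sub>m n + A + ?B) + ?B * A"
    using A B BA by (auto simp: mat_eq_iff_index[of _ n])
  moreover have "(1\<^sub>m n + A) + (1\<^sub>m n + ?B) = (1\<^sub>m n + A + ?B) + 1\<^sub>m n"
    using A B by (auto simp: mat_eq_iff_index[of _ n])
  ultimately show ?thesis
    using A B BA by (simp add: mat_add_left_cancel[of _ n])
qed

lemma add_adjoint_eq_zero_iff:
  fixes A :: "complex mat"
  assumes A: "A \<in> carrier_mat n n"
  shows "A + mat_adjoint A = 0\<^sub>m n n \<longleftrightarrow>
    (1\<^sub>m n + A) + mat_adjoint (1\<^sub>m n + A) = 2 \<cdot>\<^sub>m 1\<^sub>m n"
proof -
  note B = mat_adjoint_carrier[OF A]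
  have "mat_adjoint (1\<^sub>m n + A) = 1\<^sub>m n + mat_adjoint A"
    using A by (simp add: mat_adjoint_add[of _ n] mat_adjoint_one)
  then show ?thesis
    using A B by (simp add: mat_eq_iff_index[of _ n] del: index_one_mat(1))
qed

text \<open>Sandwich the first equation between the adjoint of \<open>Q\<close> and
  \<open>Q\<close>, the second between the adjoint of \<open>P\<close> and \<open>P\<close>; the
  products \<open>P * Q\<close> and \<open>Q * P\<close> and their adjoints collapse to 2. With
  \<open>P = 1 + A\<close> and \<open>Q = 1 + cayley n A\<close> this exchanges unitary and
  skew-Hermitian.\<close>

lemma adjoint_reciprocal_iff:
  fixes P Q :: "complex mat"
  assumes P: "P \<in> carrier_mat n n" and Q: "Q \<in> carrier_mat n n"
    and PQ: "P * Q = 2 \<cdot>\<^sub>m 1\<^sub>m n" and QP: "Q * P = 2 \<cdot>\<^sub>m 1\<^sub>m n"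
  shows "mat_adjoint P * P = P + mat_adjoint P \<longleftrightarrow> Q + mat_adjoint Q = 2 \<cdot>\<^sub>m 1\<^sub>m n"
proof
  let ?P = "mat_adjoint P" and ?Q = "mat_adjoint Q"
  note P' = mat_adjoint_carrier[OF P] and Q' = mat_adjoint_carrier[OF Q]
  have QP': "?Q * ?P = 2 \<cdot>\<^sub>m 1\<^sub>m n" and PQ': "?P * ?Q = 2 \<cdot>\<^sub>m 1\<^sub>m n"
    using arg_cong[OF PQ, of mat_adjoint] arg_cong[OF QP, of mat_adjoint] P Q
    by (simp_all add: mat_adjoint_mult[of _ n] mat_adjoint_smult[of _ n] mat_adjoint_one)
  {
    assume *: "?P * P = P + ?P"
    have "?Q * (?P * P) * Q = (?Q * ?P) * (P * Q)"
      using P Q P' Q' by (simp add: assoc_mult_mat[of _ n n _ n _ n] del: assoc_mult_mat)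
    also have "\<dots> = 2 \<cdot>\<^sub>m (2 \<cdot>\<^sub>m 1\<^sub>m n)"
      unfolding QP' PQ by (simp add: mult_smult_distrib[of _ n n _ n])
    finally have 1: "?Q * (?P * P) * Q = 2 \<cdot>\<^sub>m (2 \<cdot>\<^sub>m 1\<^sub>m n)" .
    have "?Q * (P + ?P) * Q = ?Q * (P * Q) + (?Q * ?P) * Q"
      using P Q P' Q'
      by (simp add: add_mult_distrib_mat[of _ n n _ _ n] mult_add_distrib_mat[of _ n n _ n])
    also have "\<dots> = 2 \<cdot>\<^sub>m (Q + ?Q)"
      unfolding QP' PQ using Q Q'
      by (auto simp: mult_smult_distrib[of _ n n _ n] mult_smult_assoc_mat[of _ n n _ n] mat_eq_iff_index[of _ n])
    finally show "Q + ?Q = 2 \<cdot>\<^sub>m 1\<^sub>m n"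
      using 1 Q Q' unfolding * by (simp add: smult_mat_cancel[of _ _ n])
  next
    assume *: "Q + ?Q = 2 \<cdot>\<^sub>m 1\<^sub>m n"
    have "?P * (Q + ?Q) * P = ?P * (Q * P) + (?P * ?Q) * P"
      using P Q P' Q'
      by (simp add: add_mult_distrib_mat[of _ n n _ _ n] mult_add_distrib_mat[of _ n n _ n])
    also have "\<dots> = 2 \<cdot>\<^sub>m (P + ?P)"
      unfolding QP PQ' using P P'
      by (auto simp: mult_smult_distrib[of _ n n _ n] mult_smult_assoc_mat[of _ n n _ n] mat_eq_iff_index[of _ n])
    moreover have "?P * (2 \<cdot>\<^sub>m 1\<^sub>m n) * P = 2 \<cdot>\<^sub>m (?P * P)"
      using P P' by (simp add: mult_smult_distrib[of _ n n _ n] mult_smult_assoc_mat[of _ n n _ n])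
    ultimately show "?P * P = P + ?P"
      using P P' unfolding * by (auto simp: smult_mat_cancel[of _ _ n])
  }
qed

lemma cayley_unitary_iff:
  assumes A: "A \<in> carrier_mat n n" and det: "Determinant.det (1\<^sub>m n + A) \<noteq> 0"
  shows "mat_adjoint A * A = 1\<^sub>m n \<longleftrightarrow> cayley n A + mat_adjoint (cayley n A) = 0\<^sub>m n n"
  unfolding adjoint_mult_self_eq_one_iff[OF A] add_adjoint_eq_zero_iff[OF cayley_carrier]
  by (rule adjoint_reciprocal_iff[OF one_add_carrier[OF A] _ cayley_mult[OF A det]])
    (use cayley_carrier in auto)

text \<open>A kernel vector \<open>v\<close> satisfies \<open>v = - A v\<close>, so its squared norm
  \<open>s\<close> is minus the value \<open>t\<close> of the form of \<open>A\<close> at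
  \<open>v\<close>. Skewness makes \<open>t\<close> imaginary while \<open>s\<close> is real, so
  both vanish.\<close>

lemma det_one_add_skew_nonzero:
  fixes A :: "complex mat"
  assumes A: "A \<in> carrier_mat n n" and skew: "A + mat_adjoint A = 0\<^sub>m n n"
  shows "Determinant.det (1\<^sub>m n + A) \<noteq> 0"
proof
  assume "Determinant.det (1\<^sub>m n + A) = 0"
  then obtain v where v: "v \<in> carrier_vec n" "v \<noteq> 0\<^sub>v n" "(1\<^sub>m n + A) *\<^sub>v v = 0\<^sub>v n"
    using det_0_iff_vec_prod_zero[of "1\<^sub>m n + A" n] A by auto
  have sk: "A $$ (i, j) = - cnj (A $$ (j, i))" if "i < n" "j < n" for i j
  proof -
    have "(A + mat_adjoint A) $$ (i, j) = 0" using skew that by simp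
    then show ?thesis
      using that A mat_adjoint_carrier[OF A] by (simp add: mat_adjoint_index[OF A] eq_neg_iff_add_eq_0)
  qed
  have row: "v $ i = - (\<Sum>j<n. A $$ (i, j) * v $ j)" if "i < n" for i
  proof -
    have "v + A *\<^sub>v v = 0\<^sub>v n"
      using v A by (simp add: add_mult_distrib_mat_vec[of _ n n])
    from arg_cong[OF this, of "\<lambda>u. u $ i"]
    show ?thesis using that v(1) A
      by (simp add: scalar_prod_def atLeast0LessThan eq_neg_iff_add_eq_0)
  qed
  define s where "s = (\<Sum>i<n. cnj (v $ i) * v $ i)"
  define t where "t = (\<Sum>i<n. \<Sum>j<n. cnj (v $ i) * A $$ (i, j) * v $ j)"
  have st: "s = - t"
    unfolding s_def t_def sum_negf[symmetric]
  proof (intro sum.cong refl)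
    fix i assume "i \<in> {..<n}"
    then have "cnj (v $ i) * v $ i = cnj (v $ i) * - (\<Sum>j<n. A $$ (i, j) * v $ j)"
      using row[of i] by simp
    then show "cnj (v $ i) * v $ i = (\<Sum>j<n. - (cnj (v $ i) * A $$ (i, j) * v $ j))"
      by (simp add: sum_distrib_left sum_negf mult.assoc)
  qed
  have "cnj t = (\<Sum>i<n. \<Sum>j<n. v $ i * cnj (A $$ (i, j)) * cnj (v $ j))"
    by (simp add: t_def)
  also have "\<dots> = (\<Sum>j<n. \<Sum>i<n. v $ i * cnj (A $$ (i, j)) * cnj (v $ j))"
    by (rule sum.swap)
  also have "\<dots> = - t"
    unfolding t_def sum_negf[symmetric]
  proof (intro sum.cong refl)
    fix j i assume "j \<in> {..<n}" "i \<in> {..<n}"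
    then show "v $ i * cnj (A $$ (i, j)) * cnj (v $ j) = - (cnj (v $ j) * A $$ (j, i) * v $ i)"
      using sk[of j i] by simp
  qed
  finally have "cnj t = - t" .
  moreover have "cnj s = s" by (simp add: s_def mult.commute)
  ultimately have "s = 0" using st by simp
  have "s = of_real (\<Sum>i<n. (cmod (v $ i))\<^sup>2)"
    unfolding s_def of_real_sum by (intro sum.cong refl) (metis complex_norm_square mult.commute)
  with \<open>s = 0\<close> have "(\<Sum>i<n. (cmod (v $ i))\<^sup>2) = 0" by (metis of_real_eq_0_iff)
  then have "\<forall>i<n. v $ i = 0" by (simp add: sum_nonneg_eq_0_iff)
  then have "v = 0\<^sub>v n" using v(1) by (intro eq_vecI) auto
  with v(2) show False by simp
qed

section \<open>Matrices supported on the level sets of a weight function\<close>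

definition block_mat :: "nat \<Rightarrow> (nat \<Rightarrow> nat) \<Rightarrow> complex mat \<Rightarrow> bool" where
  "block_mat n w A \<longleftrightarrow> (\<forall>i<n. \<forall>j<n. w i \<noteq> w j \<longrightarrow> A $$ (i, j) = 0)"

text \<open>Entrywise, commuting says that \<open>A $$ (i, j)\<close> takes the same value
  multiplied by \<open>w i\<close> and by \<open>w j\<close>. The blocks are level sets of
  \<open>w\<close> and need not consist of consecutive indices.\<close>

lemma block_mat_iff_commute:
  fixes A :: "complex mat"
  assumes A: "A \<in> carrier_mat n n"
  shows "block_mat n w A \<longleftrightarrow>
    A * mat_diag n (\<lambda>i. of_nat (w i)) = mat_diag n (\<lambda>i. of_nat (w i)) * A"
  unfolding mat_diag_mult_left[OF A] mat_diag_mult_right[OF A] block_mat_def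
  using A by (auto simp: mat_eq_iff_index[of _ n] mult.commute) (metis mult_cancel_right of_nat_eq_iff)

lemma block_mat_one: "block_mat n w (1\<^sub>m n)"
  by (auto simp: block_mat_def)

lemma block_mat_adjoint: "A \<in> carrier_mat n n \<Longrightarrow> block_mat n w A \<Longrightarrow> block_mat n w (mat_adjoint A)"
  by (auto simp: block_mat_def mat_adjoint_index)

lemma block_mat_add:
  assumes "A \<in> carrier_mat n n" "B \<in> carrier_mat n n" "block_mat n w A" "block_mat n w B"
  shows "block_mat n w (A + B)"
  using assms by (auto simp: block_mat_def)

lemma block_mat_mult:
  assumes A: "A \<in> carrier_mat n n" and B: "B \<in> carrier_mat n n"
    and bl: "block_mat n w A" "block_mat n w B"
  shows "block_mat n w (A * B)"
  unfolding block_mat_def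
proof (intro allI impI)
  fix i j assume ij: "i < n" "j < n" "w i \<noteq> w j"
  have "A $$ (i, k) * B $$ (k, j) = 0" if "k < n" for k
    using bl ij that by (cases "w i = w k") (auto simp: block_mat_def)
  then show "(A * B) $$ (i, j) = 0"
    using A B ij by (auto simp: scalar_prod_def intro!: sum.neutral)
qed

text \<open>Commutation with the diagonal matrix \<open>?D\<close> passes from a matrix to its
  inverse, so no cofactor has to be inspected.\<close>

lemma block_mat_adj_inverse:
  assumes A: "A \<in> carrier_mat n n" and det: "Determinant.det A \<noteq> 0" and bl: "block_mat n w A"
  shows "block_mat n w (adj_inverse A)"
proof -
  let ?D = "mat_diag n (\<lambda>i. of_nat (w i)) :: complex mat" and ?B = "adj_inverse A"
  note B = adj_inverse[OF A det]
  have D: "?D \<in> carrier_mat n n" by simp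
  have AD: "A * ?D = ?D * A" using bl by (simp add: block_mat_iff_commute[OF A])
  have "?B * ?D = ?B * (?D * (A * ?B))" using B(2) right_mult_one_mat[OF D] by simp
  also have "\<dots> = ?B * ((?D * A) * ?B)"
    using assoc_mult_mat[OF D A B(1)] by simp
  also have "\<dots> = ?B * (A * (?D * ?B))"
    using assoc_mult_mat[OF A D B(1)] unfolding AD[symmetric] by simp
  also have "\<dots> = (?B * A) * (?D * ?B)"
    using assoc_mult_mat[OF B(1) A, of "?D * ?B" n] D B(1) by simp
  also have "\<dots> = ?D * ?B" unfolding B(3) by (rule left_mult_one_mat[OF mult_carrier_mat[OF D B(1)]])
  finally show ?thesis by (simp add: block_mat_iff_commute[OF B(1)])
qed

lemma block_mat_cayley:
  assumes A: "A \<in> carrier_mat n n" and det: "Determinant.det (1\<^sub>m n + A) \<noteq> 0" and bl: "block_mat n w A"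
  shows "block_mat n w (cayley n A)"
proof -
  have "block_mat n w (adj_inverse (1\<^sub>m n + A))"
    using A det bl by (intro block_mat_adj_inverse block_mat_add block_mat_one) auto
  then show ?thesis
    using adj_inverse(1)[OF one_add_carrier[OF A] det] by (auto simp: block_mat_def cayley_def)
qed

lemma det_mat_diag: "Determinant.det (mat_diag n f) = (\<Prod>i<n. f i)"
proof -
  have "Determinant.det (mat_diag n f) = prod_list (diag_mat (mat_diag n f))"
    by (rule det_upper_triangular[of _ n]) (auto simp: mat_diag_def upper_triangular_def)
  also have "\<dots> = (\<Prod>i = 0..<n. f i)"
    unfolding prod_list_diag_prod by (rule prod.cong) (auto simp: mat_diag_def)
  finally show ?thesis by (simp add: atLeast0LessThan)
qed

lemma mat_adjoint_mat_diag: "mat_adjoint (mat_diag n f) = mat_diag n (\<lambda>i. cnj (f i))"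
  by (rule eq_matI) (auto simp: mat_adjoint_def mat_of_rows_index mat_diag_def)

section \<open>Changing the corner entry of a block unitary matrix\<close>

definition set_corner :: "nat \<Rightarrow> complex \<Rightarrow> complex mat \<Rightarrow> complex mat" where
  "set_corner n c A = Matrix.mat n n (\<lambda>(i, j). if i = 0 \<and> j = 0 then c else A $$ (i, j))"

lemma set_corner_carrier: "set_corner n c A \<in> carrier_mat n n"
  by (simp add: set_corner_def)

lemma block_mat_set_corner: "block_mat n w A \<Longrightarrow> block_mat n w (set_corner n c A)"
  by (auto simp: block_mat_def set_corner_def)

definition block_SU :: "nat \<Rightarrow> (nat \<Rightarrow> nat) \<Rightarrow> complex mat set" where
  "block_SU n w = {A \<in> SU n. block_mat n w A}"

locale isolated_corner =
  fixes n :: nat and w :: "nat \<Rightarrow> nat"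
  assumes n_pos: "0 < n" and w_corner: "\<And>i. 0 < i \<Longrightarrow> i < n \<Longrightarrow> w i \<noteq> w 0"
begin

lemma block_mat_corner_row: "block_mat n w A \<Longrightarrow> 0 < j \<Longrightarrow> j < n \<Longrightarrow> A $$ (0, j) = 0"
  using n_pos w_corner[of j] by (auto simp: block_mat_def dest!: spec[of _ 0] spec[of _ j])

text \<open>Row 0 of \<open>A\<close> vanishes off the diagonal, leaving one term of the
  sum.\<close>

lemma block_mat_mult_corner:
  assumes A: "A \<in> carrier_mat n n" and B: "B \<in> carrier_mat n n" and bl: "block_mat n w A"
  shows "(A * B) $$ (0, 0) = A $$ (0, 0) * B $$ (0, 0)"
proof -
  have "(A * B) $$ (0, 0) = (\<Sum>k\<in>{0..<n}. A $$ (0, k) * B $$ (k, 0))"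
    using A B n_pos by (simp add: scalar_prod_def)
  also have "\<dots> = (\<Sum>k\<in>{0}. A $$ (0, k) * B $$ (k, 0))"
    using block_mat_corner_row[OF bl] n_pos by (intro sum.mono_neutral_right) auto
  finally show ?thesis by simp
qed

text \<open>The corner is a block of size 1 and undergoes the scalar Cayley transform. In particular
  corner 1 and corner 0 are exchanged.\<close>

lemma cayley_corner:
  assumes A: "A \<in> carrier_mat n n" and det: "Determinant.det (1\<^sub>m n + A) \<noteq> 0" and bl: "block_mat n w A"
  shows "(1 + A $$ (0, 0)) * (1 + cayley n A $$ (0, 0)) = 2"
proof -
  have "block_mat n w (1\<^sub>m n + A)"
    using A bl by (intro block_mat_add block_mat_one) auto
  from block_mat_mult_corner[OF one_add_carrier[OF A] one_add_carrier[OF cayley_carrier] this, of A]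
  show ?thesis
    using n_pos A carrier_matD[OF cayley_carrier[of n A]] unfolding cayley_mult[OF A det] by simp
qed

text \<open>Since row 0 is zero off the corner, rescaling the corner by \<open>c\<close> is left
  multiplication by the unitary matrix \<open>diag(c, 1, ..., 1)\<close>, of determinant
  \<open>c\<close>.\<close>

lemma set_corner_unitary:
  assumes A: "A \<in> carrier_mat n n" and unit: "mat_adjoint A * A = 1\<^sub>m n" and bl: "block_mat n w A"
    and c: "cnj c * c = 1"
  shows "mat_adjoint (set_corner n (c * A $$ (0, 0)) A) * set_corner n (c * A $$ (0, 0)) A = 1\<^sub>m n"
    and "Determinant.det (set_corner n (c * A $$ (0, 0)) A) = c * Determinant.det A"
proof -
  let ?f = "\<lambda>i::nat. if i = 0 then c else 1"
  let ?D = "mat_diag n ?f"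
  have D: "?D \<in> carrier_mat n n" by simp
  have eq: "set_corner n (c * A $$ (0, 0)) A = ?D * A"
    unfolding mat_diag_mult_left[OF A] set_corner_def
    using block_mat_corner_row[OF bl] by (intro eq_matI) auto
  have "(\<lambda>i. cnj (?f i) * ?f i) = (\<lambda>i. 1)" using c by auto
  then have DD: "mat_adjoint ?D * ?D = 1\<^sub>m n"
    by (simp only: mat_adjoint_mat_diag mat_diag_diag mat_diag_one)
  have A': "mat_adjoint A \<in> carrier_mat n n" and D': "mat_adjoint ?D \<in> carrier_mat n n"
    using mat_adjoint_carrier A D by blast+
  have "mat_adjoint (?D * A) * (?D * A) = mat_adjoint A * (mat_adjoint ?D * (?D * A))"
    unfolding mat_adjoint_mult[OF D A] by (rule assoc_mult_mat[OF A' D' mult_carrier_mat[OF D A]])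
  also have "mat_adjoint ?D * (?D * A) = A"
    using assoc_mult_mat[OF D' D A] A unfolding DD by simp
  finally show "mat_adjoint (set_corner n (c * A $$ (0, 0)) A) * set_corner n (c * A $$ (0, 0)) A = 1\<^sub>m n"
    unfolding eq unit .
  have "(\<Prod>i<n. ?f i) = c" using n_pos by (simp add: prod.delta)
  then show "Determinant.det (set_corner n (c * A $$ (0, 0)) A) = c * Determinant.det A"
    unfolding eq det_mult[OF D A] det_mat_diag by simp
qed

lemma det_unitary_unit:
  assumes A: "A \<in> carrier_mat n n" and unit: "mat_adjoint A * A = 1\<^sub>m n"
  shows "cnj (Determinant.det A) * Determinant.det A = 1"
  using arg_cong[OF unit, of Determinant.det] by (simp add: det_mult[OF mat_adjoint_carrier[OF A] A] det_mat_adjoint[OF A])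

lemma SU_I:
  "A \<in> carrier_mat n n \<Longrightarrow> mat_adjoint A * A = 1\<^sub>m n \<Longrightarrow> Determinant.det A = 1 \<Longrightarrow> A \<in> SU n"
  unfolding SU_def using mat_mult_left_right_inverse[OF mat_adjoint_carrier] by blast

lemma block_SU_I:
  "A \<in> carrier_mat n n \<Longrightarrow> mat_adjoint A * A = 1\<^sub>m n \<Longrightarrow> Determinant.det A = 1 \<Longrightarrow>
    block_mat n w A \<Longrightarrow> A \<in> block_SU n w"
  unfolding block_SU_def by (simp add: SU_I)

lemma block_SU_D:
  assumes "A \<in> block_SU n w"
  shows "A \<in> carrier_mat n n" "mat_adjoint A * A = 1\<^sub>m n" "A * mat_adjoint A = 1\<^sub>m n"
    "Determinant.det A = 1" "block_mat n w A"
  using assms by (auto simp: block_SU_def SU_def)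

lemma block_SU_mult:
  assumes "A \<in> block_SU n w" "B \<in> block_SU n w"
  shows "A * B \<in> block_SU n w"
proof -
  note A = block_SU_D[OF assms(1)] and B = block_SU_D[OF assms(2)]
  note A' = mat_adjoint_carrier[OF A(1)] and B' = mat_adjoint_carrier[OF B(1)]
  have "mat_adjoint (A * B) * (A * B) = mat_adjoint B * (mat_adjoint A * (A * B))"
    unfolding mat_adjoint_mult[OF A(1) B(1)] by (rule assoc_mult_mat[OF B' A' mult_carrier_mat[OF A(1) B(1)]])
  also have "mat_adjoint A * (A * B) = B"
    using assoc_mult_mat[OF A' A(1) B(1)] B(1) unfolding A(2) by simp
  finally show ?thesis
    using block_SU_I[OF mult_carrier_mat[OF A(1) B(1)]] block_mat_mult[OF A(1) B(1) A(5) B(5)]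
      det_mult[OF A(1) B(1)] A(4) B(2,4) by simp
qed

lemma block_SU_adjoint:
  assumes "A \<in> block_SU n w"
  shows "mat_adjoint A \<in> block_SU n w"
proof -
  note A = block_SU_D[OF assms]
  show ?thesis
    by (rule block_SU_I) (simp_all add: A mat_adjoint_carrier mat_adjoint_adjoint[OF A(1)]
        det_mat_adjoint[OF A(1)] block_mat_adjoint)
qed

lemma one_in_block_SU: "1\<^sub>m n \<in> block_SU n w"
  by (rule block_SU_I) (simp_all add: block_mat_one mat_adjoint_one)

text \<open>The corner of \<open>A\<close> has modulus 1, so setting it to 1 multiplies it, and
  hence the determinant, by its conjugate. The reciprocal of the new determinant is thus the old
  corner.\<close>

lemma block_SU_normalize_corner:
  assumes "A \<in> block_SU n w"
  defines "U \<equiv> set_corner n 1 A"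
  shows "mat_adjoint U * U = 1\<^sub>m n" "set_corner n (1 / Determinant.det U) U = A"
proof -
  note A = block_SU_D[OF assms(1)]
  let ?c = "cnj (A $$ (0, 0))"
  have "A $$ (0, 0) * ?c = 1"
    using block_mat_mult_corner[OF A(1) mat_adjoint_carrier[OF A(1)] A(5)] n_pos
    unfolding A(3) by (simp add: mat_adjoint_index[OF A(1)])
  then have c: "?c * A $$ (0, 0) = 1" "cnj ?c * ?c = 1" by (simp_all add: mult.commute)
  note corner = set_corner_unitary[OF A(1,2,5) c(2)]
  show "mat_adjoint U * U = 1\<^sub>m n"
    using corner(1) unfolding c(1) U_def .
  have "Determinant.det U = ?c" using corner(2) unfolding c(1) U_def A(4) by simp
  then have "1 / Determinant.det U = A $$ (0, 0)"
    using c(1) by (auto simp: divide_eq_eq mult.commute)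
  then show "set_corner n (1 / Determinant.det U) U = A"
    using A(1) by (auto simp: U_def set_corner_def intro!: eq_matI)
qed

text \<open>Converse of the normalization: together they identify \<open>block_SU n w\<close> with
  the unitary block matrices of corner 1.\<close>

lemma set_corner_in_block_SU:
  assumes U: "U \<in> carrier_mat n n" and unit: "mat_adjoint U * U = 1\<^sub>m n" and bl: "block_mat n w U"
    and corner: "U $$ (0, 0) = 1"
  shows "set_corner n (1 / Determinant.det U) U \<in> block_SU n w"
    and "set_corner n 1 (set_corner n (1 / Determinant.det U) U) = U"
proof -
  let ?c = "1 / Determinant.det U"
  have "cnj (Determinant.det U) * Determinant.det U = 1" by (rule det_unitary_unit[OF U unit])
  then have c: "cnj ?c * ?c = 1" "Determinant.det U \<noteq> 0"
    by (cases "Determinant.det U = 0"; simp)+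
  show "set_corner n (1 / Determinant.det U) U \<in> block_SU n w"
    using set_corner_unitary[OF U unit bl c(1)] c(2) block_mat_set_corner[OF bl]
    unfolding corner mult_1_right by (intro block_SU_I set_corner_carrier) simp_all
  show "set_corner n 1 (set_corner n ?c U) = U"
    using U corner by (auto simp: set_corner_def intro!: eq_matI)
qed

end

section \<open>The Hamiltonian and binary weights\<close>

lemma kronecker_mat_diag:
  fixes f g :: "nat \<Rightarrow> 'a::semiring_0"
  shows "mat_diag m f \<otimes>\<^sub>K mat_diag n g = mat_diag (m * n) (\<lambda>i. f (i div n) * g (i mod n))"
proof (rule eq_matI)
  fix i j assume "i < dim_row (mat_diag (m * n) (\<lambda>i. f (i div n) * g (i mod n)))"
    "j < dim_col (mat_diag (m * n) (\<lambda>i. f (i div n) * g (i mod n)))"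
  then have ij: "i < m * n" "j < m * n" by (simp_all add: mat_diag_def)
  then have "n > 0" by (cases n) auto
  moreover have "i = j \<longleftrightarrow> i div n = j div n \<and> i mod n = j mod n" by (metis div_mult_mod_eq)
  ultimately show "(mat_diag m f \<otimes>\<^sub>K mat_diag n g) $$ (i, j) = mat_diag (m * n) (\<lambda>i. f (i div n) * g (i mod n)) $$ (i, j)"
    using ij by (auto simp: kronecker_def mat_diag_def less_mult_imp_div_less)
qed (simp_all add: kronecker_def mat_diag_def)

lemma mat_diag_cong: "(\<And>i. i < n \<Longrightarrow> f i = g i) \<Longrightarrow> mat_diag n f = mat_diag n g"
  by (auto simp: mat_diag_def intro!: eq_matI)

lemma kronecker_power_sigma0: "kronecker_power sigma0 k = mat_diag (2 ^ k) (\<lambda>i. 1)"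
proof (induction k)
  case (Suc k)
  have "kronecker_power sigma0 (Suc k) = mat_diag (2 ^ k) (\<lambda>i. 1) \<otimes>\<^sub>K mat_diag 2 (\<lambda>i. 1)"
    using Suc by (simp add: sigma0_def)
  then show ?case by (simp only: kronecker_mat_diag) (simp add: mult.commute)
qed simp

text \<open>Reading the diagonal entries 0 and 1 as their own index turns each summand of the
  Hamiltonian into a binary digit.\<close>

lemma qubit_H_eq: "qubit_H = mat_diag 2 of_nat"
proof (rule eq_matI)
  fix i j assume "i < dim_row (mat_diag 2 of_nat :: complex mat)" "j < dim_col (mat_diag 2 of_nat :: complex mat)"
  then have "i \<in> {0, 1}" "j \<in> {0, 1}" by (auto simp: mat_diag_def)
  then show "qubit_H $$ (i, j) = mat_diag 2 of_nat $$ (i, j)"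
    by (auto simp: qubit_H_def mat_diag_def mat_of_rows_list_def)
qed (simp_all add: qubit_H_def mat_diag_def mat_of_rows_list_def)

lemma finsum_mat_diag:
  fixes f :: "'b \<Rightarrow> nat \<Rightarrow> 'a::comm_ring_1"
  assumes "finite S"
  shows "finsum (module_mat TYPE('a) n n) (\<lambda>j. mat_diag n (f j)) S = mat_diag n (\<lambda>i. \<Sum>j\<in>S. f j i)"
  using assms
proof (induction S)
  interpret abelian_group "module_mat TYPE('a) n n" by (rule abelian_group_mat)
  {
    case empty
    show ?case by (simp add: module_mat_simps) (auto simp: mat_diag_def)
  next
    case (insert a S)
    then show ?case
      by (subst finsum_insert) (auto simp: module_mat_simps, auto simp: mat_diag_def)
  }
qed

lemma sum_binary_digits:
  assumes "i < 2 ^ N"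
  shows "(\<Sum>k<N. i div 2 ^ k mod 2) = card (set_decode i)"
proof -
  have "k < N" if "odd (i div 2 ^ k)" for k
  proof (rule ccontr)
    assume "\<not> k < N"
    then have "(2::nat) ^ N \<le> 2 ^ k" by (intro power_increasing) auto
    with assms have "i < 2 ^ k" by (rule less_le_trans)
    then have "i div 2 ^ k = 0" by simp
    with that show False by simp
  qed
  then have "set_decode i = {k \<in> {..<N}. odd (i div 2 ^ k)}" by (auto simp: set_decode_def)
  then have "card (set_decode i) = (\<Sum>k<N. if odd (i div 2 ^ k) then 1 else 0)"
    by (simp add: sum.If_cases Collect_conj_eq lessThan_def)
  also have "\<dots> = (\<Sum>k<N. i div 2 ^ k mod 2)"
    by (intro sum.cong refl) (auto simp: odd_iff_mod_2_eq_one)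
  finally show ?thesis by simp
qed

text \<open>The energy of the basis state with index \<open>i\<close> is the number of binary digits 1 of \<open>i\<close>,
  and \<open>set_decode i\<close> is the set of positions of these digits.\<close>

lemma hamiltonian_eq: "hamiltonian N = mat_diag (2 ^ N) (\<lambda>i. of_nat (card (set_decode i)))"
proof -
  interpret abelian_group "module_mat TYPE(complex) (2 ^ N) (2 ^ N)" by (rule abelian_group_mat)
  have "kronecker_power sigma0 (j - 1) \<otimes>\<^sub>K qubit_H \<otimes>\<^sub>K kronecker_power sigma0 (N - j) =
      mat_diag (2 ^ N) (\<lambda>i. of_nat (i div 2 ^ (N - j) mod 2))" if "j \<in> {1..N}" for j
  proof -
    have "(2::nat) ^ (j - 1) * 2 * 2 ^ (N - j) = 2 ^ (Suc (j - 1) + (N - j))"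
      by (simp add: power_add)
    also have "Suc (j - 1) + (N - j) = N" using that by auto
    finally show ?thesis
      unfolding kronecker_power_sigma0 qubit_H_eq kronecker_mat_diag
      by (auto intro!: mat_diag_cong)
  qed
  then have "hamiltonian N =
      finsum (module_mat TYPE(complex) (2 ^ N) (2 ^ N)) (\<lambda>j. mat_diag (2 ^ N) (\<lambda>i. of_nat (i div 2 ^ (N - j) mod 2))) {1..N}"
    unfolding hamiltonian_def by (intro finsum_cong') (auto simp: module_mat_simps)
  also have "\<dots> = mat_diag (2 ^ N) (\<lambda>i. \<Sum>j=1..N. of_nat (i div 2 ^ (N - j) mod 2))"
    by (rule finsum_mat_diag) simp
  also have "\<dots> = mat_diag (2 ^ N) (\<lambda>i. of_nat (card (set_decode i)))"
  proof (rule mat_diag_cong)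
    fix i :: nat assume i: "i < 2 ^ N"
    \<comment> \<open>The leftmost tensor factor carries the most significant digit, so factor
      \<open>j\<close> reads the digit at position \<open>N - j\<close>.\<close>
    have "(\<Sum>j=1..N. i div 2 ^ (N - j) mod 2) = (\<Sum>k<N. i div 2 ^ k mod 2)"
      by (rule sum.reindex_bij_witness[of _ "\<lambda>k. N - k" "\<lambda>j. N - j"]) auto
    then show "(\<Sum>j=1..N. of_nat (i div 2 ^ (N - j) mod 2)) = (of_nat (card (set_decode i)) :: complex)"
      unfolding sum_binary_digits[OF i, symmetric] of_nat_sum[symmetric] by simp
  qed
  finally show ?thesis .
qed

section \<open>Counting pairs of indices of equal weight\<close>

lemma bij_betw_set_decode: "bij_betw set_decode {..<2 ^ N} (Pow {..<N})"
proof (rule bij_betw_byWitness[where f' = set_encode])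
  show "set_decode ` {..<2 ^ N} \<subseteq> Pow {..<N}"
  proof safe
    fix i k :: nat assume i: "i < 2 ^ N" and k: "k \<in> set_decode i"
    show "k < N"
    proof (rule ccontr)
      assume "\<not> k < N"
      then have "(2::nat) ^ N \<le> 2 ^ k" by (intro power_increasing) auto
      with i have "i < 2 ^ k" by (rule less_le_trans)
      then have "i div 2 ^ k = 0" by simp
      with k show False by (simp add: set_decode_def)
    qed
  qed
  show "set_encode ` Pow {..<N} \<subseteq> {..<2 ^ N}"
  proof clarify
    fix A :: "nat set" assume "A \<subseteq> {..<N}"
    then have "set_encode A \<le> (\<Sum>k<N. 2 ^ k)"
      unfolding set_encode_def by (intro sum_mono2) auto
    also have "\<dots> < 2 ^ N" by (simp add: sum_power2 lessThan_atLeast0)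
    finally show "set_encode A < 2 ^ N" .
  qed
  show "\<forall>A\<in>Pow {..<N}. set_decode (set_encode A) = A"
    using finite_subset[OF _ finite_lessThan] by simp
qed simp

lemma card_set_decode_level: "card {i. i < 2 ^ N \<and> card (set_decode i) = k} = N choose k"
proof -
  have "bij_betw set_decode {i. i < 2 ^ N \<and> card (set_decode i) = k} {A. A \<subseteq> {..<N} \<and> card A = k}"
    using bij_betw_Collect[OF bij_betw_set_decode[of N], of "\<lambda>A. card A = k" "\<lambda>i. card (set_decode i) = k"]
    by (simp add: Collect_conj_eq lessThan_def Pow_def)
  from bij_betw_same_card[OF this] show ?thesis by (simp add: n_subsets)
qed

lemma card_equal_weight_pairs:
  "card {(i, j). i < 2 ^ N \<and> j < 2 ^ N \<and> card (set_decode i) = card (set_decode j)} = 2 * N choose N"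
proof -
  let ?L = "\<lambda>k. {i. i < 2 ^ N \<and> card (set_decode i) = k}"
  have le: "card (set_decode i) \<le> N" if "i < 2 ^ N" for i
    using bij_betw_apply[OF bij_betw_set_decode, of i N] that card_mono[of "{..<N}" "set_decode i"] by auto
  have "{(i, j). i < 2 ^ N \<and> j < 2 ^ N \<and> card (set_decode i) = card (set_decode j)} = (\<Union>k\<le>N. ?L k \<times> ?L k)"
    using le by auto
  then have "card {(i, j). i < 2 ^ N \<and> j < 2 ^ N \<and> card (set_decode i) = card (set_decode j)} =
      card (\<Union>k\<le>N. ?L k \<times> ?L k)"
    by (rule arg_cong)
  also have "\<dots> = (\<Sum>k\<le>N. card (?L k \<times> ?L k))"
    by (rule card_UN_disjoint) auto
  also have "\<dots> = (\<Sum>k\<le>N. (N choose k)\<^sup>2)"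
    by (simp only: card_cartesian_product card_set_decode_level power2_eq_square)
  also have "\<dots> = 2 * N choose N" by (rule choose_square_sum)
  finally show ?thesis .
qed

section \<open>Growth of the central binomial coefficient\<close>

lemma central_binomial_rec:
  "(2 * Suc n choose Suc n) * (n + 1) = 2 * (2 * n + 1) * (2 * n choose n)"
proof -
  define D E C where "D = (2 * Suc n choose Suc n)" and "E = (Suc (2 * n) choose n)" and "C = (2 * n choose n)"
  \<comment> \<open>Two absorption identities, linked by the intermediate coefficient
    \<open>E\<close>.\<close>
  have "Suc n * D = 2 * Suc n * E"
    using Suc_times_binomial_eq[of "Suc (2 * n)" n] by (simp add: D_def E_def mult.commute)
  moreover have "(n + 1) * E = (2 * n + 1) * C"
    using binomial_absorb_comp[of "Suc (2 * n)" n] by (simp add: E_def C_def)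
  ultimately have "D * (n + 1) = 2 * (2 * n + 1) * C"
    by (simp add: mult.commute mult.left_commute)
  then show ?thesis by (simp only: D_def C_def)
qed

text \<open>Squaring keeps the bound in the natural numbers. The factor \<open>2 * n + 1\<close>
  makes the induction close, as \<open>(2 * n + 1) * (2 * n + 3)\<close> is at most the square of
  \<open>2 * n + 2\<close>; with the factor \<open>n\<close> the step would fail.\<close>

lemma central_binomial_square_le: "(2 * n choose n)\<^sup>2 * (2 * n + 1) \<le> 16 ^ n"
proof (induction n)
  case (Suc n)
  define C D where "C = (2 * n choose n)" and "D = (2 * Suc n choose Suc n)"
  have D: "D * (n + 1) = 2 * (2 * n + 1) * C"
    unfolding C_def D_def by (rule central_binomial_rec)
  have "(D\<^sup>2 * (2 * Suc n + 1)) * (n + 1)\<^sup>2 = (D * (n + 1))\<^sup>2 * (2 * n + 3)"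
    by (simp add: power2_eq_square algebra_simps)
  also have "\<dots> = 4 * (C\<^sup>2 * (2 * n + 1)) * ((2 * n + 1) * (2 * n + 3))"
    unfolding D by (simp add: power2_eq_square algebra_simps)
  also have "\<dots> \<le> 4 * 16 ^ n * (4 * (n + 1)\<^sup>2)"
  proof (rule mult_mono)
    show "4 * (C\<^sup>2 * (2 * n + 1)) \<le> 4 * 16 ^ n"
      using Suc.IH by (simp only: C_def mult_le_mono2)
    show "(2 * n + 1) * (2 * n + 3) \<le> 4 * (n + 1)\<^sup>2"
      by (simp add: power2_eq_square algebra_simps)
  qed simp_all
  also have "\<dots> = 16 ^ Suc n * (n + 1)\<^sup>2" by simp
  finally have "D\<^sup>2 * (2 * Suc n + 1) \<le> 16 ^ Suc n"
    by (rule mult_right_le_imp_le) simp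
  then show ?case by (simp only: D_def)
qed simp

lemma central_binomial_bigo: "(\<lambda>N. real (2 * N choose N)) \<in> O(\<lambda>N. 4 ^ N / sqrt (real N))"
proof (rule landau_o.big_mono, rule eventually_mono[OF eventually_gt_at_top[of 0]])
  fix N :: nat assume N: "0 < N"
  have "real ((2 * N choose N)\<^sup>2 * (2 * N + 1)) \<le> real (16 ^ N)"
    using central_binomial_square_le[of N] of_nat_le_iff by blast
  moreover have "(real (2 * N choose N))\<^sup>2 * real N \<le> real ((2 * N choose N)\<^sup>2 * (2 * N + 1))"
    unfolding of_nat_mult of_nat_power by (intro mult_left_mono) auto
  ultimately have "(real (2 * N choose N))\<^sup>2 * real N \<le> real (16 ^ N)" by linarith
  then have "(real (2 * N choose N) * sqrt N)\<^sup>2 \<le> (4 ^ N)\<^sup>2"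
    using power_mult[of "4::real" 2 N] by (simp add: power_mult_distrib power_even_eq)
  then have "real (2 * N choose N) * sqrt N \<le> 4 ^ N"
    by (rule power2_le_imp_le) simp
  then show "norm (real (2 * N choose N)) \<le> norm (4 ^ N / sqrt (real N))"
    using N by (simp add: field_simps)
qed

section \<open>Charts of the block unitary group\<close>

definition mat_of_coords :: "nat \<Rightarrow> (nat \<times> nat \<times> bool \<Rightarrow> real) \<Rightarrow> complex mat" where
  "mat_of_coords n x = Matrix.mat n n (\<lambda>(i, j). Complex (x (i, j, False)) (x (i, j, True)))"

lemma mat_of_coords_carrier: "mat_of_coords n x \<in> carrier_mat n n"
  by (simp add: mat_of_coords_def)

lemma mat_of_coords_mat_coords: "A \<in> carrier_mat n n \<Longrightarrow> mat_of_coords n (mat_coords n A) = A"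
  by (auto simp: mat_of_coords_def mat_coords_def complex_eq_iff intro!: eq_matI)

lemma mat_coords_in_coord_space: "mat_coords n A \<in> coord_space (mat_index n)"
  by (auto simp: mat_coords_def coord_space_def mat_index_def)

lemma smooth_mat_of_coords: "smooth_mat I U n (mat_of_coords n)"
proof (rule smooth_matI)
  fix i j assume "i < n" "j < n"
  then have "mat_of_coords n x $$ (i, j) = Complex (x (i, j, False)) (x (i, j, True))" for x
    by (simp add: mat_of_coords_def)
  then show "smooth_complex I U (\<lambda>x. mat_of_coords n x $$ (i, j))"
    by (simp add: smooth_complex_Complex C_k_on_coordinate)
qed (rule mat_of_coords_carrier)

lemma smooth_map_mat_coords:
  assumes "smooth_mat I U n F"
  shows "smooth_map I U (mat_index n) (\<lambda>x. mat_coords n (F x))"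
  unfolding smooth_map_def
proof (intro conjI ballI allI)
  fix k and s :: "nat \<times> nat \<times> bool" assume "s \<in> mat_index n"
  then obtain i j b where s: "s = (i, j, b)" "i < n" "j < n" by (auto simp: mat_index_def)
  then show "C_k_on I U k (\<lambda>x. mat_coords n (F x) s)"
    using smooth_matD(2)[OF assms s(2,3)] by (cases b) (auto simp: mat_coords_def smooth_complex_def)
qed (rule mat_coords_in_coord_space)

lemma smooth_mat_set_corner:
  assumes "smooth_complex I U f" "smooth_mat I U n F"
  shows "smooth_mat I U n (\<lambda>x. set_corner n (f x) (F x))"
proof (rule smooth_matI)
  fix i j assume ij: "i < n" "j < n"
  then show "smooth_complex I U (\<lambda>x. set_corner n (f x) (F x) $$ (i, j))"
    using assms(1) smooth_matD(2)[OF assms(2) ij] by (cases "i = 0 \<and> j = 0") (auto simp: set_corner_def)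
qed (rule set_corner_carrier)

lemma smooth_mat_cayley:
  assumes F: "smooth_mat I U n F" and det: "\<forall>x\<in>U. Determinant.det (1\<^sub>m n + F x) \<noteq> 0"
  shows "smooth_mat I U n (\<lambda>x. cayley n (F x))"
proof -
  have "smooth_mat I U n (\<lambda>x. 1\<^sub>m n + F x)"
    by (intro smooth_mat_add smooth_mat_const F) simp
  then show ?thesis
    unfolding cayley_def adj_inverse_def
    by (intro smooth_mat_diff smooth_mat_smult smooth_mat_adj_mat smooth_complex_divide
        smooth_complex_det smooth_complex_const smooth_mat_const det one_carrier_mat)
qed

text \<open>The skew-Hermitian matrices correspond linearly to the arbitrary real matrices \<open>y\<close>, by
  \<open>X\<^sub>i\<^sub>j = (y\<^sub>i\<^sub>j - y\<^sub>j\<^sub>i) + \<i> (y\<^sub>i\<^sub>j + y\<^sub>j\<^sub>i)\<close> and \<open>y\<^sub>i\<^sub>j = (Re X\<^sub>i\<^sub>j + Im X\<^sub>i\<^sub>j) / 2\<close>. The parameters \<open>x\<close> are the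
  entries of \<open>y\<close> at \<open>block_positions\<close>, enumerated by \<open>e\<close> with inverse \<open>e'\<close>.\<close>

context isolated_corner
begin

text \<open>Dropping the position \<open>(0, 0)\<close> keeps the corner of the skew-Hermitian
  matrix at 0; this is the dimension taken by the determinant condition.\<close>

definition block_positions :: "(nat \<times> nat) set" where
  "block_positions = {(i, j). i < n \<and> j < n \<and> w i = w j} - {(0, 0)}"

definition skew_of :: "(nat \<times> nat \<Rightarrow> nat) \<Rightarrow> (nat \<Rightarrow> real) \<Rightarrow> complex mat" where
  "skew_of e' x = (let y = (\<lambda>s. if s \<in> block_positions then x (e' s) else 0) in
     Matrix.mat n n (\<lambda>(i, j). Complex (y (i, j) - y (j, i)) (y (i, j) + y (j, i))))"

definition skew_coords :: "nat \<Rightarrow> (nat \<Rightarrow> nat \<times> nat) \<Rightarrow> complex mat \<Rightarrow> nat \<Rightarrow> real" where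
  "skew_coords d e X = (\<lambda>k. if k < d then (Re (X $$ e k) + Im (X $$ e k)) / 2 else 0)"

lemma skew_of_carrier: "skew_of e' x \<in> carrier_mat n n"
  by (simp add: skew_of_def Let_def)

lemma skew_of_skew: "skew_of e' x + mat_adjoint (skew_of e' x) = 0\<^sub>m n n"
  using skew_of_carrier[of e' x] mat_adjoint_carrier[OF skew_of_carrier[of e' x]]
  by (simp add: mat_eq_iff_index[of _ n] mat_adjoint_index[OF skew_of_carrier])
    (simp add: skew_of_def Let_def complex_eq_iff)

lemma skew_of_block: "block_mat n w (skew_of e' x)"
  by (auto simp: block_mat_def skew_of_def Let_def block_positions_def complex_eq_iff)

lemma skew_of_corner: "skew_of e' x $$ (0, 0) = 0"
  using n_pos by (simp add: skew_of_def Let_def block_positions_def complex_eq_iff)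

lemma smooth_skew_of: "smooth_mat I U n (skew_of e')"
proof (rule smooth_matI)
  fix i j assume ij: "i < n" "j < n"
  have "C_k_on I U k (\<lambda>x. if s \<in> block_positions then x (e' s) else 0)" for s k
    by (cases "s \<in> block_positions") (auto intro: C_k_on_coordinate C_k_on_const)
  then have "C_k_on I U k (\<lambda>x. (if (i, j) \<in> block_positions then x (e' (i, j)) else 0) + c * (if (j, i) \<in> block_positions then x (e' (j, i)) else 0))" for k c
    by (intro C_k_on_add C_k_on_mult C_k_on_const)
  from this[of _ "-1"] this[of _ 1]
  show "smooth_complex I U (\<lambda>x. skew_of e' x $$ (i, j))"
    using ij by (simp add: smooth_complex_def skew_of_def Let_def)
qed (rule skew_of_carrier)

text \<open>In the sum of real and imaginary part the parameter of the transposed position cancels.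
  Diagonal positions obey the same formula, so index pairs need no ordering.\<close>

lemma skew_coords_skew_of:
  assumes "\<forall>k<d. e k \<in> block_positions \<and> e' (e k) = k" "x \<in> coord_space {..<d}"
  shows "skew_coords d e (skew_of e' x) = x"
proof
  fix k
  show "skew_coords d e (skew_of e' x) k = x k"
  proof (cases "k < d")
    case True
    obtain i j where ij: "e k = (i, j)" by fastforce
    with True assms(1) have "(i, j) \<in> block_positions" "e' (i, j) = k" by force+
    then show ?thesis
      using True by (auto simp: skew_coords_def skew_of_def Let_def ij) (auto simp: block_positions_def)
  qed (use assms(2) in \<open>auto simp: skew_coords_def coord_space_def\<close>)
qed

text \<open>Skewness negates the real part and keeps the imaginary part under transposition, so half
  sums at \<open>(i, j)\<close> and \<open>(j, i)\<close> recover both. Entries without a parameter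
  vanish by block form or by the corner hypothesis.\<close>

lemma skew_of_skew_coords:
  assumes e: "\<forall>s\<in>block_positions. e' s < d \<and> e (e' s) = s"
    and X: "X \<in> carrier_mat n n" and skew: "X + mat_adjoint X = 0\<^sub>m n n" and bl: "block_mat n w X"
    and corner: "X $$ (0, 0) = 0"
  shows "skew_of e' (skew_coords d e X) = X"
proof -
  have "skew_of e' (skew_coords d e X) $$ (i, j) = X $$ (i, j)" if ij: "i < n" "j < n" for i j
  proof (cases "(i, j) \<in> block_positions")
    case True
    then have "(j, i) \<in> block_positions" by (auto simp: block_positions_def)
    moreover have "X $$ (i, j) = - cnj (X $$ (j, i))"
      using ij X mat_adjoint_carrier[OF X] skew
      by (simp add: mat_eq_iff_index[of _ n] mat_adjoint_index[OF X] eq_neg_iff_add_eq_0)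
    ultimately show ?thesis
      using ij True e by (simp add: skew_of_def skew_coords_def Let_def complex_eq_iff field_simps)
  next
    case False
    then have "X $$ (i, j) = 0"
      using bl corner ij by (auto simp: block_positions_def block_mat_def)
    moreover have "(j, i) \<notin> block_positions" using False by (auto simp: block_positions_def)
    ultimately show ?thesis
      using ij False by (simp add: skew_of_def Let_def complex_eq_iff)
  qed
  then show ?thesis using X skew_of_carrier by (simp add: mat_eq_iff_index[of _ n])
qed

text \<open>Near \<open>P\<close> the chart sends \<open>A\<close> to the Cayley transform of \<open>P\<^sup>-\<^sup>1 A\<close> with corner entry replaced
  by 1: the first row and column of a block matrix vanish off the diagonal, so the corner entry is
  the inverse of the determinant of the rest.\<close>

theorem mat_submanifold_block_SU: "mat_submanifold n (card block_positions) (block_SU n w)"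
  unfolding mat_submanifold_def smooth_submanifold_def
proof (intro conjI ballI)
  show "block_SU n w \<subseteq> carrier_mat n n" using block_SU_D(1) by blast
  show "mat_coords n ` block_SU n w \<subseteq> coord_space (mat_index n)"
    using mat_coords_in_coord_space by blast
  fix p assume "p \<in> mat_coords n ` block_SU n w"
  then obtain P where P: "P \<in> block_SU n w" "p = mat_coords n P" by blast
  let ?d = "card block_positions" and ?I = "mat_index n" and ?P = "mat_adjoint P"
  note Pc = block_SU_D[OF P(1)]
  note P' = mat_adjoint_carrier[OF Pc(1)]
  have "finite block_positions"
    by (rule finite_subset[of _ "{..<n} \<times> {..<n}"]) (auto simp: block_positions_def)
  then obtain e where e: "bij_betw e {..<?d} block_positions"
    using ex_bij_betw_nat_finite[of block_positions] by (auto simp: atLeast0LessThan)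
  define e' where "e' = the_inv_into {..<?d} e"
  have e1: "\<forall>k<?d. e k \<in> block_positions \<and> e' (e k) = k"
    using e by (auto simp: e'_def bij_betw_def the_inv_into_f_f)
  have e2: "\<forall>s\<in>block_positions. e' s < ?d \<and> e (e' s) = s"
  proof
    fix s assume "s \<in> block_positions"
    then obtain k where "k < ?d" "s = e k" using e unfolding bij_betw_def by blast
    then show "e' s < ?d \<and> e (e' s) = s" using e1 by simp
  qed
  \<comment> \<open>\<open>R\<close> is defined for arbitrary matrix coordinates, so
    \<open>\<phi>\<close> extends smoothly off the group to the ambient set \<open>V\<close> on
    which the Cayley transform of \<open>R x\<close> is regular.\<close>
  define R where "R = (\<lambda>x. set_corner n 1 (?P * mat_of_coords n x))"
  define V where "V = {x \<in> coord_space ?I. Determinant.det (1\<^sub>m n + R x) \<noteq> 0}"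
  define Q where "Q = (\<lambda>x. cayley n (skew_of e' x))"
  define \<phi> where "\<phi> = (\<lambda>x. skew_coords ?d e (cayley n (R x)))"
  \<comment> \<open>Corner \<open>1 / det\<close> brings the determinant of \<open>Q x\<close> to 1;
    multiplication by \<open>P\<close> undoes the translation.\<close>
  define T where "T = (\<lambda>x. P * set_corner n (1 / Determinant.det (Q x)) (Q x))"
  define \<psi> where "\<psi> = (\<lambda>x. mat_coords n (T x))"
  have smR: "smooth_mat ?I U n R" for U
    unfolding R_def by (intro smooth_mat_set_corner smooth_complex_const smooth_mat_mult
        smooth_mat_const P' smooth_mat_of_coords)
  have detX: "Determinant.det (1\<^sub>m n + skew_of e' x) \<noteq> 0" for x
    by (rule det_one_add_skew_nonzero[OF skew_of_carrier skew_of_skew])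
  have Q: "Q x \<in> carrier_mat n n" "mat_adjoint (Q x) * Q x = 1\<^sub>m n" "block_mat n w (Q x)"
      "Q x $$ (0, 0) = 1" "cayley n (Q x) = skew_of e' x" "Determinant.det (1\<^sub>m n + Q x) \<noteq> 0" for x
  proof -
    note X = skew_of_carrier[of e' x] and d = detX[of x]
    show "Q x \<in> carrier_mat n n" unfolding Q_def by (rule cayley_carrier)
    show cc: "cayley n (Q x) = skew_of e' x" unfolding Q_def by (rule cayley_cayley[OF X d])
    show d': "Determinant.det (1\<^sub>m n + Q x) \<noteq> 0" unfolding Q_def by (rule det_one_add_cayley[OF X d])
    show "mat_adjoint (Q x) * Q x = 1\<^sub>m n"
      using cayley_unitary_iff[OF \<open>Q x \<in> carrier_mat n n\<close> d'] skew_of_skew unfolding cc by simp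
    show "block_mat n w (Q x)" unfolding Q_def by (rule block_mat_cayley[OF X d skew_of_block])
    show "Q x $$ (0, 0) = 1"
      using cayley_corner[OF X d skew_of_block] unfolding Q_def skew_of_corner by simp
  qed
  have detQ: "Determinant.det (Q x) \<noteq> 0" for x
    using det_unitary_unit[OF Q(1,2)[of x]] by auto
  have T: "T x \<in> block_SU n w" for x
    unfolding T_def by (intro block_SU_mult P(1) set_corner_in_block_SU Q)
  have PP: "?P * (P * A) = A" "P * (?P * A) = A" if "A \<in> carrier_mat n n" for A
    using assoc_mult_mat[OF P' Pc(1) that] assoc_mult_mat[OF Pc(1) P' that] that
    unfolding Pc(2,3) by simp_all
  \<comment> \<open>Translation and corner change cancel, so \<open>\<phi>\<close> after
    \<open>\<psi>\<close> reduces to the involution property of the Cayley transform.\<close>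
  have RT: "R (\<psi> x) = Q x" for x
  proof -
    have "R (\<psi> x) = set_corner n 1 (?P * T x)"
      unfolding R_def \<psi>_def using mat_of_coords_mat_coords block_SU_D(1)[OF T[of x]] by simp
    also have "?P * T x = set_corner n (1 / Determinant.det (Q x)) (Q x)"
      unfolding T_def by (rule PP(1)[OF set_corner_carrier])
    also have "set_corner n 1 \<dots> = Q x" by (rule set_corner_in_block_SU(2)[OF Q(1-4)])
    finally show ?thesis .
  qed
  have \<psi>V: "\<psi> x \<in> V" for x
  proof -
    have "\<psi> x \<in> coord_space ?I" unfolding \<psi>_def by (rule mat_coords_in_coord_space)
    then show ?thesis unfolding V_def using Q(6)[of x] by (simp add: RT)
  qed
  have \<phi>\<psi>: "\<phi> (\<psi> x) = x" if "x \<in> coord_space {..<?d}" for x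
    unfolding \<phi>_def RT Q(5) by (rule skew_coords_skew_of[OF e1 that])
  have \<psi>\<phi>: "\<psi> (\<phi> x) = x" "\<phi> x \<in> coord_space {..<?d}"
    if x: "x \<in> V" "x \<in> mat_coords n ` block_SU n w" for x
  proof -
    obtain A where A: "A \<in> block_SU n w" "x = mat_coords n A" using x(2) by blast
    have mx: "mat_of_coords n x = A" unfolding A(2) by (rule mat_of_coords_mat_coords[OF block_SU_D(1)[OF A(1)]])
    have d: "Determinant.det (1\<^sub>m n + R x) \<noteq> 0" using x(1) by (simp add: V_def)
    have B: "?P * A \<in> block_SU n w" by (intro block_SU_mult block_SU_adjoint P(1) A(1))
    have Rx: "R x = set_corner n 1 (?P * A)" by (simp add: R_def mx)
    have Rc: "R x \<in> carrier_mat n n" unfolding Rx by (rule set_corner_carrier)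
    have Ru: "mat_adjoint (R x) * R x = 1\<^sub>m n"
      unfolding Rx by (rule block_SU_normalize_corner[OF B])
    have Rb: "block_mat n w (R x)"
      unfolding Rx by (rule block_mat_set_corner[OF block_SU_D(5)[OF B]])
    have R00: "R x $$ (0, 0) = 1" using n_pos by (simp add: Rx set_corner_def)
    have skew: "cayley n (R x) + mat_adjoint (cayley n (R x)) = 0\<^sub>m n n"
      using cayley_unitary_iff[OF Rc d] Ru by simp
    have c0: "cayley n (R x) $$ (0, 0) = 0"
      using cayley_corner[OF Rc d Rb] unfolding R00 by (simp add: algebra_simps)
    have "skew_of e' (\<phi> x) = cayley n (R x)"
      unfolding \<phi>_def by (rule skew_of_skew_coords[OF e2 cayley_carrier skew block_mat_cayley[OF Rc d Rb] c0])
    then have "Q (\<phi> x) = R x" unfolding Q_def using cayley_cayley[OF Rc d] by simp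
    then have "T (\<phi> x) = P * (?P * A)"
      unfolding T_def Rx using block_SU_normalize_corner(2)[OF B] by simp
    also have "\<dots> = A" by (rule PP(2)[OF block_SU_D(1)[OF A(1)]])
    finally show "\<psi> (\<phi> x) = x" unfolding \<psi>_def A(2) by simp
    show "\<phi> x \<in> coord_space {..<?d}" by (auto simp: \<phi>_def skew_coords_def coord_space_def)
  qed
  have "open_in_coord_space ?I V"
  proof -
    have "smooth_mat ?I U n (\<lambda>x. 1\<^sub>m n + R x)" for U
      by (intro smooth_mat_add smooth_mat_const smR) simp
    then have "continuous_on (coord_space ?I) (\<lambda>x. Determinant.det (1\<^sub>m n + R x))"
      by (intro smooth_complex_continuous_on[of ?I] smooth_complex_det)
    from continuous_openin_preimage_gen[OF this, of "- {0}"]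
    have "openin (top_of_set (coord_space ?I)) (coord_space ?I \<inter> (\<lambda>x. Determinant.det (1\<^sub>m n + R x)) -` (- {0}))"
      by (simp add: open_Compl)
    also have "coord_space ?I \<inter> (\<lambda>x. Determinant.det (1\<^sub>m n + R x)) -` (- {0}) = V"
      by (auto simp: V_def)
    finally show ?thesis by (simp add: open_in_coord_space_def)
  qed
  moreover have "p \<in> V"
  proof -
    \<comment> \<open>At the centre of the chart \<open>R p\<close> is the identity, so
      \<open>1 + R p\<close> is twice the identity and invertible.\<close>
    have "mat_of_coords n p = P" unfolding P(2) by (rule mat_of_coords_mat_coords[OF Pc(1)])
    then have "1\<^sub>m n + R p = 2 \<cdot>\<^sub>m 1\<^sub>m n"
      unfolding R_def by (auto simp: Pc(2) set_corner_def intro!: eq_matI)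
    then show ?thesis unfolding V_def P(2) by (simp add: mat_coords_in_coord_space)
  qed
  \<comment> \<open>By \<open>detX\<close> every parameter vector is admissible, so \<open>W\<close>
    is the whole space.\<close>
  moreover have "open_in_coord_space {..<?d} (coord_space {..<?d})"
    by (simp add: open_in_coord_space_def)
  moreover have "smooth_map ?I V {..<?d} \<phi>"
    unfolding smooth_map_def
  proof (intro conjI ballI allI)
    fix x show "\<phi> x \<in> coord_space {..<?d}" by (auto simp: \<phi>_def skew_coords_def coord_space_def)
  next
    fix j k assume j: "j \<in> {..<?d}"
    obtain a b where ab: "e j = (a, b)" by fastforce
    have "e j \<in> block_positions" using j e1 by simp
    then have "a < n" "b < n" unfolding ab by (auto simp: block_positions_def)
    moreover have "smooth_mat ?I V n (\<lambda>x. cayley n (R x))"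
      by (intro smooth_mat_cayley smR) (simp add: V_def)
    ultimately have "smooth_complex ?I V (\<lambda>x. cayley n (R x) $$ e j)"
      unfolding ab by (intro smooth_matD(2))
    then have "C_k_on ?I V k (\<lambda>x. (Re (cayley n (R x) $$ e j) + Im (cayley n (R x) $$ e j)) * (1 / 2))"
      unfolding smooth_complex_def by (intro C_k_on_add C_k_on_mult C_k_on_const) auto
    then show "C_k_on ?I V k (\<lambda>x. \<phi> x j)"
      using j by (simp add: \<phi>_def skew_coords_def)
  qed
  moreover have "smooth_map {..<?d} (coord_space {..<?d}) ?I \<psi>"
  proof -
    have "smooth_mat {..<?d} (coord_space {..<?d}) n Q"
      unfolding Q_def using detX by (intro smooth_mat_cayley smooth_skew_of) simp
    then have "smooth_mat {..<?d} (coord_space {..<?d}) n T"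
      unfolding T_def using detQ
      by (intro smooth_mat_mult smooth_mat_const Pc(1) smooth_mat_set_corner smooth_complex_divide
          smooth_complex_const smooth_complex_det) simp_all
    then show ?thesis unfolding \<psi>_def by (rule smooth_map_mat_coords)
  qed
  moreover have "\<psi> ` coord_space {..<?d} = V \<inter> mat_coords n ` block_SU n w"
  proof (intro equalityI subsetI)
    fix y assume "y \<in> \<psi> ` coord_space {..<?d}"
    then show "y \<in> V \<inter> mat_coords n ` block_SU n w" using \<psi>V T unfolding \<psi>_def by blast
  next
    fix y assume "y \<in> V \<inter> mat_coords n ` block_SU n w"
    then have "y = \<psi> (\<phi> y)" "\<phi> y \<in> coord_space {..<?d}" using \<psi>\<phi>[of y] by auto
    then show "y \<in> \<psi> ` coord_space {..<?d}" by (rule image_eqI)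
  qed
  moreover have "\<forall>x\<in>coord_space {..<?d}. \<phi> (\<psi> x) = x" using \<phi>\<psi> by blast
  ultimately show "\<exists>V W \<phi> \<psi>.
      open_in_coord_space ?I V \<and> p \<in> V \<and> open_in_coord_space {..<?d} W \<and>
      smooth_map ?I V {..<?d} \<phi> \<and> smooth_map {..<?d} W ?I \<psi> \<and>
      \<psi> ` W = V \<inter> mat_coords n ` block_SU n w \<and> (\<forall>w\<in>W. \<phi> (\<psi> w) = w)"
    by (intro exI conjI)
qed

end

section \<open>The dimension of the energy-preserving group\<close>

lemma energy_preserving_SU_eq:
  "energy_preserving_SU N = block_SU (2 ^ N) (\<lambda>i. card (set_decode i))"
proof -
  have "A * hamiltonian N = hamiltonian N * A \<longleftrightarrow> block_mat (2 ^ N) (\<lambda>i. card (set_decode i)) A"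
    if "A \<in> SU (2 ^ N)" for A
    using that block_mat_iff_commute[of A "2 ^ N" "\<lambda>i. card (set_decode i)"]
    unfolding hamiltonian_eq by (simp add: SU_def)
  then show ?thesis by (auto simp: energy_preserving_SU_def block_SU_def)
qed

theorem theorem4p11:
  shows "(\<forall>N\<ge>1.
            mat_submanifold (2 ^ N) ((2 * N choose N) - 1) (energy_preserving_SU N) \<and>
            manifold_dim (2 ^ N) (energy_preserving_SU N) = (2 * N choose N) - 1) \<and>
         (\<lambda>N. real (manifold_dim (2 ^ N) (energy_preserving_SU N))) \<in> O(\<lambda>N. 4 ^ N / sqrt (real N))"
proof -
  have sub: "mat_submanifold (2 ^ N) ((2 * N choose N) - 1) (energy_preserving_SU N)"
    and dim: "manifold_dim (2 ^ N) (energy_preserving_SU N) = (2 * N choose N) - 1" for N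
  proof -
    interpret isolated_corner "2 ^ N" "\<lambda>i. card (set_decode i)"
    proof
      fix i :: nat assume "0 < i"
      \<comment> \<open>Only 0 has no binary digit 1, so the state of weight 0 is alone in its
        block.\<close>
      then have "set_decode i \<noteq> {}" by (metis less_irrefl set_decode_inverse set_decode_zero)
      then show "card (set_decode i) \<noteq> card (set_decode 0)" by (simp add: card_eq_0_iff)
    qed simp
    have "card block_positions = (2 * N choose N) - 1"
      unfolding block_positions_def by (subst card_Diff_singleton) (auto simp: card_equal_weight_pairs)
    then show 1: "mat_submanifold (2 ^ N) ((2 * N choose N) - 1) (energy_preserving_SU N)"
      using mat_submanifold_block_SU by (simp add: energy_preserving_SU_eq)
    show "manifold_dim (2 ^ N) (energy_preserving_SU N) = (2 * N choose N) - 1"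
      using one_in_block_SU by (intro manifold_dim_eq[OF 1]) (auto simp: energy_preserving_SU_eq)
  qed
  \<comment> \<open>Subtracting 1 in the natural numbers never increases the value, so the constant
    1 works for every \<open>N\<close>.\<close>
  have "(\<lambda>N. real ((2 * N choose N) - 1)) \<in> O(\<lambda>N. real (2 * N choose N))"
    by (intro landau_o.big_mono always_eventually) simp
  then have "(\<lambda>N. real ((2 * N choose N) - 1)) \<in> O(\<lambda>N. 4 ^ N / sqrt (real N))"
    using central_binomial_bigo by (rule landau_o.big_trans)
  then show ?thesis using sub dim by simp
qed

end
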